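(* Let $(X,\varphi,D,I)$ be a regular impulsive dynamical system on a compact metric space $(X,d)$, with $\xi>0$ the constant appearing in the definition of regularity, and let $\phi:\mathbb{R}_0^+\times X\to X$ be its associated impulsive semiflow. Then there exist a compact metric space $Y$, a continuous semiflow $\tilde\phi:\mathbb{R}_0^+\times Y\to Y$ and a uniformly continuous bijection $H:X_\xi\to Y$ such that for all $t\ge0$ $$\tilde\phi_t\circ H=H\circ\phi_t \quad\text{on } X_\xi.$$ Moreover, $$h_{top}(\tilde\phi)=\hat h_{\mathrm s}(\phi).$$
   Context: A semiflow on $X$ is a map $\phi:\mathbb{R}_0^+\times X\to X$, $\phi_t(x)=\phi(t,x)$, with $\phi_0=\mathrm{id}$ and $\phi_{s+t}=\phi_s\circ\phi_t$, not necessarily continuous. Impulsive systems. Let $\varphi:\mathbb{R}_0^+\times X\to X$ be a continuous semiflow, $D\subset X$ a proper closed subset, $I:D\to X$ continuous. Put $\tau_1(x)=\inf\{t>0:\varphi_t(x)\in D\}$ if $\varphi_t(x)\in D$ for some $t>0$, and $\tau_1(x)=+\infty$ otherwise. If $\tau_1(x)<\infty$ put $x^1=\varphi_{\tau_1(x)}(x)$. Inductively, if $\tau_n(x)<\infty$, put $\tau_{n+1}(x)=\tau_1(x)+\sum_{k=1}^n\tau_1(I(x^k))$ and, if $\tau_1(I(x^n))<\infty$, $x^{n+1}=\varphi_{\tau_1(I(x^n))}(I(x^n))$. Let $T(x)=\sup\{\tau_n(x):n\ge1\}$ and define $\gamma_x:[0,T(x))\to X$ by $\gamma_x(t)=\varphi_t(x)$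 for $t\in[0,\tau_1(x))$ and $\gamma_x(t)=\varphi_{t-\tau_n(x)}(I(x^n))$ for $t\in[\tau_n(x),\tau_{n+1}(x))$ when $\tau_n(x)<\infty$. $(X,\varphi,D,I)$ is an impulsive dynamical system if $\tau_1(x)>0$ and $T(x)=\infty$ for all $x\in X$; its associated impulsive semiflow is $\phi_t(x)=\gamma_x(t)$. Regularity. For $\eta>0$ put $D_\eta=\bigcup_{x\in D}\{\varphi_t(x):0<t<\eta\}$ and $X_\eta=X\setminus(D\cup D_\eta)$. The system is regular if $I(D)\cap D=\emptyset$, $I$ is Lipschitz, and there exist $\eta>0$ and $0<\xi<\eta/4$ such that (1) $D_\xi$ is open; (2) $\varphi_\xi(D_\xi)\subset X_\xi$; (3) for all $x\in I(D)$ and $t\in(0,\xi]$, $\varphi_t(x)\notin I(D)$. Entropies. For a semiflow $\phi$ on a metric space $(X,d)$ and $\delta>0$ put $d_\delta^\phi(x,y)=\inf\{d(\phi_s(x),\phi_s(y)):s\in[0,\delta)\}$. A set $E\subseteq X$ is $(\phi,T,\varepsilon,\delta)$-separated if for all distinct $x,y\in E$ there is $t\in[0,T]$ with $d_\delta^\phi(\phi_t(x),\phi_t(y))\ge\varepsilon$. With $\hat s(\phi,T,\varepsilon,\delta)=\sup\{|E|:E\text{ is }(\phi,T,\varepsilon,\delta)\text{-separated}\}$ (possibly $\infty$, $\log\infty=\infty$), $$\hat h_{\mathrm s}(\phi)=\lim_{\delta\to0^+}\lim_{\varepsilon\to0^+}\limsup_{T\to+\infty}\tfrac1T\log\hat s(\phi,T,\varepsilon,\delta).$$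 $h_{top}$ denotes Bowen's classical topological entropy of a continuous semiflow on a compact metric space: $h_{top}(\tilde\phi)=\lim_{\varepsilon\to0^+}\limsup_{T\to+\infty}\frac1T\log s(\tilde\phi,T,\varepsilon)$, where $s(\tilde\phi,T,\varepsilon)$ is the supremum of cardinalities of sets in which any two distinct points $x,y$ are at distance at least $\varepsilon$ under $\tilde\phi_t$ for some $t\in[0,T]$.
   Formalization: The claim is for constants ξ with I(D) disjoint from D_ξ (shown to exist for every regular system); for other admissible ξ, orbits of X_ξ can jump into D_ξ, so H∘φ_t is undefined on X_ξ (circle rotation, D={0}, I(0)=ξ/2). *)

theory Defs
  imports "HOL-Analysis.Analysis"
begin

text \<open>
  A flow is a function \<open>\<phi> t x\<close> with real time \<open>t\<close>; only its values at \<open>t \<ge> 0\<close> are used.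
\<close>

definition semiflow_on :: "'a set \<Rightarrow> (real \<Rightarrow> 'a \<Rightarrow> 'a) \<Rightarrow> bool" where
  "semiflow_on S \<phi> \<longleftrightarrow>
     (\<forall>t\<ge>0. \<forall>x\<in>S. \<phi> t x \<in> S) \<and>
     (\<forall>x\<in>S. \<phi> 0 x = x) \<and>
     (\<forall>s\<ge>0. \<forall>t\<ge>0. \<forall>x\<in>S. \<phi> (s + t) x = \<phi> s (\<phi> t x))"

definition continuous_semiflow :: "'a topology \<Rightarrow> (real \<Rightarrow> 'a \<Rightarrow> 'a) \<Rightarrow> bool" where
  "continuous_semiflow U \<phi> \<longleftrightarrow>
     semiflow_on (topspace U) \<phi> \<and>
     continuous_map (prod_topology (top_of_set {0..}) U) U (\<lambda>(t, x). \<phi> t x)"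


section \<open>Impulsive dynamical systems\<close>

text \<open>The infimum of the empty set is \<open>\<infinity>\<close> in \<^typ>\<open>ereal\<close>.\<close>

definition first_hit :: "(real \<Rightarrow> 'a \<Rightarrow> 'a) \<Rightarrow> 'a set \<Rightarrow> 'a \<Rightarrow> ereal" where
  "first_hit \<phi> D x = Inf (ereal ` {t. 0 < t \<and> \<phi> t x \<in> D})"

definition hit_point :: "(real \<Rightarrow> 'a \<Rightarrow> 'a) \<Rightarrow> 'a set \<Rightarrow> 'a \<Rightarrow> 'a" where
  "hit_point \<phi> D x = \<phi> (real_of_ereal (first_hit \<phi> D x)) x"

text \<open>
  The point from which the motion restarts after \<open>n\<close> impulses, i.e.\ \<open>x\<close> for \<open>n = 0\<close> and
  \<open>I(x\<^sup>n)\<close> for \<open>n \<ge> 1\<close>, where \<open>x\<^sup>n\<close> is the hit point of \<open>restart_point \<phi> D I x (n - 1)\<close>. The value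
  is meaningful only if the \<open>n\<close>-th impulse time is finite.
\<close>

primrec restart_point ::
  "(real \<Rightarrow> 'a \<Rightarrow> 'a) \<Rightarrow> 'a set \<Rightarrow> ('a \<Rightarrow> 'a) \<Rightarrow> 'a \<Rightarrow> nat \<Rightarrow> 'a" where
  "restart_point \<phi> D I x 0 = x"
| "restart_point \<phi> D I x (Suc n) = I (hit_point \<phi> D (restart_point \<phi> D I x n))"

text \<open>
  This is \<open>\<tau>\<^sub>n(x)\<close> for \<open>n \<ge> 1\<close>, with the convention \<open>\<tau>\<^sub>0(x) = 0\<close>. Once some \<open>\<tau>\<^sub>n(x)\<close> is infinite,
  all later ones are infinite too, because the summands are nonnegative; this does not affect
  the supremum of the impulse times.
\<close>

definition impulse_time ::
  "(real \<Rightarrow> 'a \<Rightarrow> 'a) \<Rightarrow> 'a set \<Rightarrow> ('a \<Rightarrow> 'a) \<Rightarrow> 'a \<Rightarrow> nat \<Rightarrow> ereal" where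
  "impulse_time \<phi> D I x n = (\<Sum>k<n. first_hit \<phi> D (restart_point \<phi> D I x k))"

text \<open>
  With \<open>\<tau>\<^sub>0(x) = 0\<close>, the intervals \<open>[\<tau>\<^sub>n(x), \<tau>\<^sub>n\<^sub>+\<^sub>1(x))\<close>, \<open>n \<ge> 0\<close>, partition \<open>[0, T(x))\<close>; the index \<open>n\<close>
  below is that of the interval containing \<open>t\<close>.
\<close>

definition impulsive_semiflow ::
  "(real \<Rightarrow> 'a \<Rightarrow> 'a) \<Rightarrow> 'a set \<Rightarrow> ('a \<Rightarrow> 'a) \<Rightarrow> real \<Rightarrow> 'a \<Rightarrow> 'a" where
  "impulsive_semiflow \<phi> D I t x =
     (let n = (THE n. impulse_time \<phi> D I x n \<le> ereal t \<and> ereal t < impulse_time \<phi> D I x (Suc n))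
      in \<phi> (t - real_of_ereal (impulse_time \<phi> D I x n)) (restart_point \<phi> D I x n))"

text \<open>
  The phase space is the whole type; the impulse map \<open>I\<close> is only relevant on \<open>D\<close>.
\<close>

definition impulsive_system ::
  "(real \<Rightarrow> 'a \<Rightarrow> 'a) \<Rightarrow> 'a::metric_space set \<Rightarrow> ('a \<Rightarrow> 'a) \<Rightarrow> bool" where
  "impulsive_system \<phi> D I \<longleftrightarrow>
     continuous_semiflow euclidean \<phi> \<and>
     closed D \<and> D \<noteq> UNIV \<and>
     continuous_on D I \<and>
     (\<forall>x. 0 < first_hit \<phi> D x) \<and>
     (\<forall>x. (SUP n\<in>{1..}. impulse_time \<phi> D I x n) = \<infinity>)"

definition tube :: "(real \<Rightarrow> 'a \<Rightarrow> 'a) \<Rightarrow> 'a set \<Rightarrow> real \<Rightarrow> 'a set" where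
  "tube \<phi> D \<eta> = (\<Union>x\<in>D. {\<phi> t x |t. 0 < t \<and> t < \<eta>})"

definition off_tube :: "(real \<Rightarrow> 'a \<Rightarrow> 'a) \<Rightarrow> 'a set \<Rightarrow> real \<Rightarrow> 'a set" where
  "off_tube \<phi> D \<eta> = UNIV - (D \<union> tube \<phi> D \<eta>)"

definition regularity_constants ::
  "(real \<Rightarrow> 'a \<Rightarrow> 'a) \<Rightarrow> 'a::metric_space set \<Rightarrow> ('a \<Rightarrow> 'a) \<Rightarrow> real \<Rightarrow> real \<Rightarrow> bool" where
  "regularity_constants \<phi> D I \<eta> \<xi> \<longleftrightarrow>
     0 < \<eta> \<and> 0 < \<xi> \<and> \<xi> < \<eta> / 4 \<and>
     open (tube \<phi> D \<xi>) \<and>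
     \<phi> \<xi> ` tube \<phi> D \<xi> \<subseteq> off_tube \<phi> D \<xi> \<and>
     (\<forall>x\<in>I ` D. \<forall>t\<in>{0<..\<xi>}. \<phi> t x \<notin> I ` D)"

definition regular_impulsive_system ::
  "(real \<Rightarrow> 'a \<Rightarrow> 'a) \<Rightarrow> 'a::metric_space set \<Rightarrow> ('a \<Rightarrow> 'a) \<Rightarrow> bool" where
  "regular_impulsive_system \<phi> D I \<longleftrightarrow>
     impulsive_system \<phi> D I \<and>
     I ` D \<inter> D = {} \<and>
     (\<exists>L. L-lipschitz_on D I) \<and>
     (\<exists>\<eta> \<xi>. regularity_constants \<phi> D I \<eta> \<xi>)"


section \<open>Entropies\<close>

definition ecard :: "'a set \<Rightarrow> enat" where
  "ecard E = (if finite E then enat (card E) else \<infinity>)"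

definition log_enat :: "enat \<Rightarrow> ereal" where
  "log_enat n = (case n of enat k \<Rightarrow> if k = 0 then -\<infinity> else ereal (ln (real k)) | \<infinity> \<Rightarrow> \<infinity>)"

definition growth_rate :: "(real \<Rightarrow> enat) \<Rightarrow> ereal" where
  "growth_rate s = Limsup at_top (\<lambda>T. ereal (1 / T) * log_enat (s T))"

definition separated_set ::
  "'a metric \<Rightarrow> (real \<Rightarrow> 'a \<Rightarrow> 'a) \<Rightarrow> real \<Rightarrow> real \<Rightarrow> 'a set \<Rightarrow> bool" where
  "separated_set m \<psi> T \<epsilon> E \<longleftrightarrow>
     E \<subseteq> mspace m \<and>
     (\<forall>x\<in>E. \<forall>y\<in>E. x \<noteq> y \<longrightarrow> (\<exists>t\<in>{0..T}. \<epsilon> \<le> mdist m (\<psi> t x) (\<psi> t y)))"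

definition top_entropy :: "'a metric \<Rightarrow> (real \<Rightarrow> 'a \<Rightarrow> 'a) \<Rightarrow> ereal" where
  "top_entropy m \<psi> =
     Lim (at_right 0) (\<lambda>\<epsilon>. growth_rate (\<lambda>T. SUP E\<in>Collect (separated_set m \<psi> T \<epsilon>). ecard E))"

definition delta_dist ::
  "'a metric \<Rightarrow> (real \<Rightarrow> 'a \<Rightarrow> 'a) \<Rightarrow> real \<Rightarrow> 'a \<Rightarrow> 'a \<Rightarrow> real" where
  "delta_dist m \<phi> \<delta> x y = (INF s\<in>{0..<\<delta>}. mdist m (\<phi> s x) (\<phi> s y))"

definition delta_separated_set ::
  "'a metric \<Rightarrow> (real \<Rightarrow> 'a \<Rightarrow> 'a) \<Rightarrow> real \<Rightarrow> real \<Rightarrow> real \<Rightarrow> 'a set \<Rightarrow> bool" where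
  "delta_separated_set m \<phi> T \<epsilon> \<delta> E \<longleftrightarrow>
     E \<subseteq> mspace m \<and>
     (\<forall>x\<in>E. \<forall>y\<in>E. x \<noteq> y \<longrightarrow> (\<exists>t\<in>{0..T}. \<epsilon> \<le> delta_dist m \<phi> \<delta> (\<phi> t x) (\<phi> t y)))"

definition hat_entropy :: "'a metric \<Rightarrow> (real \<Rightarrow> 'a \<Rightarrow> 'a) \<Rightarrow> ereal" where
  "hat_entropy m \<phi> =
     Lim (at_right 0) (\<lambda>\<delta>. Lim (at_right 0) (\<lambda>\<epsilon>.
       growth_rate (\<lambda>T. SUP E\<in>Collect (delta_separated_set m \<phi> T \<epsilon> \<delta>). ecard E)))"

end

theory Submission
  imports Defs
begin

text \<open>
  The points of \<open>X\<^sub>\<xi>\<close> themselves serve as the points of \<open>Y\<close>: the set \<open>X\<^sub>\<xi> \<union> D\<close> is compact, being the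
  complement of the open set \<open>D\<^sub>\<xi>\<close>, and gluing every \<open>z \<in> D\<close> to \<open>I z\<close> turns it into a compact metric
  space on \<open>X\<^sub>\<xi>\<close> whose distance is at most \<open>d\<close>, so that \<open>H\<close> can be the identity. An orbit cannot enter
  \<open>D\<^sub>\<xi>\<close> except through \<open>D\<close>; hence the hitting time of \<open>D\<close> is continuous on \<open>X\<^sub>\<xi> \<union> D\<close>, and the
  impulsive semiflow, whose jumps have become invisible, is continuous in the glued metric.

  For the entropies, separation in the glued metric persists for a short time and is dominated by
  separation in \<open>d\<close>, which gives one inequality. Conversely, two points that are close in the glued
  metric are close in \<open>d\<close> shortly afterwards, once both have jumped; moreover the impulsive semiflow
  maps \<open>X\<close> into \<open>X\<^sub>\<xi>\<close> at time \<open>\<xi>\<close>, and \<open>X\<close> splits into finitely many pieces without separation before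
  that time, which only costs a constant factor.
\<close>

section \<open>Impulsive semiflows\<close>

text \<open>The flow need not be injective, so a priori a point of the tube could be reached from D
  after different times. The inclusion of \<phi>_\<xi>(D_\<xi>) in X_\<xi> replaces backward
  uniqueness: it forces every representation of a point as the image of some z in D at a time in
  [0,\<xi>] to have the same time, its level, and so D behaves like a one-sided cross-section.
  Openness of D_\<xi> supplies stability: an orbit that starts in X_\<xi> near one crossing D has to
  cross D as well. Taking the glued distance as a supremum over 1-Lipschitz functions that agree at
  z and I z makes the triangle inequality and the bound by d immediate and moves all the work into
  the separation of points. In the entropy comparison, a point just before D and a point near its
  image under I are close in the glued metric but far apart in d, so separation in d cannot be
  bounded at the same instant. The infimum over [0,\<delta>) in the entropy of \<phi> permits the
  comparison at a slightly later instant.\<close>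

locale impulsive =
  fixes \<phi> :: "real \<Rightarrow> 'a::metric_space \<Rightarrow> 'a" and D :: "'a set" and I :: "'a \<Rightarrow> 'a"
  assumes impulsive_system: "impulsive_system \<phi> D I"
begin

abbreviation \<tau> :: "'a \<Rightarrow> ereal" where "\<tau> \<equiv> first_hit \<phi> D"

abbreviation F :: "real \<Rightarrow> 'a \<Rightarrow> 'a" where "F \<equiv> impulsive_semiflow \<phi> D I"

abbreviation jump_time :: "'a \<Rightarrow> nat \<Rightarrow> ereal" where "jump_time \<equiv> impulse_time \<phi> D I"

lemma flow_0 [simp]: "\<phi> 0 x = x"
  using impulsive_system
  by (simp add: impulsive_system_def continuous_semiflow_def semiflow_on_def)

lemma flow_add: "0 \<le> s \<Longrightarrow> 0 \<le> t \<Longrightarrow> \<phi> (s + t) x = \<phi> s (\<phi> t x)"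
  using impulsive_system
  by (simp add: impulsive_system_def continuous_semiflow_def semiflow_on_def)

lemma flow_diff: "0 \<le> t \<Longrightarrow> t \<le> s \<Longrightarrow> \<phi> s x = \<phi> (s - t) (\<phi> t x)"
  using flow_add[of "s - t" t x] by simp

lemma continuous_flow: "continuous_on ({0..} \<times> UNIV) (\<lambda>(t, x). \<phi> t x)"
proof -
  have "prod_topology (top_of_set {0::real..}) (euclidean :: 'a topology) =
      top_of_set ({0..} \<times> UNIV)"
    using prod_topology_subtopology_eu[of "{0::real..}" "UNIV :: 'a set"] by simp
  then show ?thesis
    using impulsive_system by (simp add: impulsive_system_def continuous_semiflow_def)
qed

lemma flow_tendsto:
  assumes "(t \<longlongrightarrow> t0) A" "(x \<longlongrightarrow> x0) A" "0 \<le> t0" "\<forall>\<^sub>F n in A. 0 \<le> t n"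
  shows "((\<lambda>n. \<phi> (t n) (x n)) \<longlongrightarrow> \<phi> t0 x0) A"
  using continuous_on_tendsto_compose[OF continuous_flow tendsto_Pair[OF assms(1,2)]] assms(3,4)
  by simp

lemma closed_D: "closed D"
  using impulsive_system by (simp add: impulsive_system_def)

lemma first_hit_pos: "0 < \<tau> x"
  using impulsive_system by (simp add: impulsive_system_def)

lemma first_hit_le: "0 < t \<Longrightarrow> \<phi> t x \<in> D \<Longrightarrow> \<tau> x \<le> ereal t"
  unfolding first_hit_def by (intro Inf_lower) auto

lemma less_first_hit: "0 < t \<Longrightarrow> ereal t < \<tau> x \<Longrightarrow> \<phi> t x \<notin> D"
  using first_hit_le by fastforce

lemma first_hit_less_iff: "\<tau> x < a \<longleftrightarrow> (\<exists>t>0. \<phi> t x \<in> D \<and> ereal t < a)"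
  unfolding first_hit_def by (auto simp: Inf_less_iff)

lemma first_hit_cases:
  obtains (infinite) "\<tau> x = \<infinity>" | (finite) r where "0 < r" "\<tau> x = ereal r"
  using first_hit_pos[of x] by (cases "\<tau> x") auto

lemma flow_first_hit:
  assumes "\<tau> x = ereal r" shows "\<phi> r x \<in> D"
proof -
  have "0 < r" using first_hit_pos[of x] assms by simp
  have "\<exists>t>0. \<phi> t x \<in> D \<and> t < r + 1 / real (Suc n)" for n
    using first_hit_less_iff[of x "ereal (r + 1 / real (Suc n))"] assms by auto
  then obtain t where t: "\<And>n. 0 < t n" "\<And>n. \<phi> (t n) x \<in> D" "\<And>n. t n < r + 1 / real (Suc n)"
    by metis
  have "r \<le> t n" for n using first_hit_le[OF t(1,2)] assms by (metis ereal_less_eq(3))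
  have "(\<lambda>n. r + 1 / real (Suc n)) \<longlonglongrightarrow> r"
    using tendsto_add[OF tendsto_const LIMSEQ_Suc[OF lim_1_over_n], of r] by simp
  then have "t \<longlonglongrightarrow> r"
    using tendsto_sandwich[of "\<lambda>_. r" t sequentially "\<lambda>n. r + 1 / real (Suc n)" r]
      \<open>\<And>n. r \<le> t n\<close> t(3) by (simp add: less_imp_le del: of_nat_Suc)
  then have "(\<lambda>n. \<phi> (t n) x) \<longlonglongrightarrow> \<phi> r x"
    by (rule flow_tendsto) (use t(1) \<open>0 < r\<close> in \<open>auto simp: less_imp_le\<close>)
  then show ?thesis using closed_sequentially[OF closed_D, of "\<lambda>n. \<phi> (t n) x"] t(2) by blast
qed

lemma first_hit_flow:
  assumes "0 \<le> t" "ereal t < \<tau> x" shows "\<tau> x = \<tau> (\<phi> t x) + ereal t"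
proof (rule antisym)
  show "\<tau> x \<le> \<tau> (\<phi> t x) + ereal t"
  proof (cases "\<phi> t x" rule: first_hit_cases)
    case (finite r)
    then have "\<phi> (r + t) x \<in> D" using flow_first_hit[OF finite(2)] assms(1) by (simp add: flow_add)
    then show ?thesis using first_hit_le[of "r + t" x] finite assms(1) by simp
  qed simp
next
  show "\<tau> (\<phi> t x) + ereal t \<le> \<tau> x"
  proof (cases x rule: first_hit_cases)
    case (finite r)
    then have "t < r" using assms by simp
    then have "\<phi> (r - t) (\<phi> t x) \<in> D"
      using flow_first_hit[OF finite(2)] flow_diff[of t r x] assms(1) by simp
    then have "\<tau> (\<phi> t x) \<le> ereal (r - t)" using \<open>t < r\<close> by (intro first_hit_le) auto
    then have "\<tau> (\<phi> t x) + ereal t \<le> ereal (r - t) + ereal t" by (rule add_right_mono)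
    then show ?thesis using finite by simp
  qed simp
qed

section \<open>Impulse times and the recursive description of the impulsive semiflow\<close>

lemma jump_time_0 [simp]: "jump_time x 0 = 0"
  by (simp add: impulse_time_def)

lemma restart_point_Suc_shift:
  "restart_point \<phi> D I x (Suc n) = restart_point \<phi> D I (I (hit_point \<phi> D x)) n"
  by (induction n) simp_all

lemma jump_time_Suc_shift: "jump_time x (Suc n) = \<tau> x + jump_time (I (hit_point \<phi> D x)) n"
  unfolding impulse_time_def sum.lessThan_Suc_shift restart_point_Suc_shift by simp

lemma jump_time_Suc: "jump_time x (Suc n) = jump_time x n + \<tau> (restart_point \<phi> D I x n)"
  unfolding impulse_time_def by simp

lemma jump_time_mono: "m \<le> n \<Longrightarrow> jump_time x m \<le> jump_time x n"
  by (rule lift_Suc_mono_le[of "jump_time x"])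
    (simp_all add: jump_time_Suc ereal_le_add_self first_hit_pos less_imp_le)

lemma jump_time_nonneg: "0 \<le> jump_time x n"
  using jump_time_mono[of 0 n x] by simp

lemma ex_jump_time_greater: "\<exists>n. ereal t < jump_time x (Suc n)"
proof -
  have "(SUP n\<in>{1..}. jump_time x n) = \<infinity>"
    using impulsive_system by (simp add: impulsive_system_def)
  then have "ereal t < (SUP n\<in>{1..}. jump_time x n)" by simp
  then obtain n where "n \<ge> 1" "ereal t < jump_time x n" by (auto simp: less_SUP_iff)
  then show ?thesis by (cases n) auto
qed

lemma ex_jump_index:
  assumes "0 \<le> t"
  obtains n where "jump_time x n \<le> ereal t" "ereal t < jump_time x (Suc n)"
proof -
  define n where "n = (LEAST n. ereal t < jump_time x (Suc n))"
  have "ereal t < jump_time x (Suc n)"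
    unfolding n_def using ex_jump_time_greater by (rule LeastI_ex)
  moreover have "jump_time x n \<le> ereal t"
  proof (cases n)
    case (Suc m)
    then have "\<not> ereal t < jump_time x (Suc m)" unfolding n_def by (intro not_less_Least) auto
    then show ?thesis using Suc by (simp add: not_less)
  qed (use assms in simp)
  ultimately show thesis using that by blast
qed

text \<open>The intervals between consecutive impulse times are disjoint because
  \<open>jump_time\<close> is monotone, so the definite description in the semiflow can be evaluated
  at any index that fits.\<close>

lemma impulsive_semiflow_eq:
  assumes "jump_time x n \<le> ereal t" "ereal t < jump_time x (Suc n)"
  shows "F t x = \<phi> (t - real_of_ereal (jump_time x n)) (restart_point \<phi> D I x n)"
proof -
  have "m = n" if "jump_time x m \<le> ereal t" "ereal t < jump_time x (Suc m)" for m
  proof (rule ccontr)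
    assume "m \<noteq> n"
    then consider "Suc m \<le> n" | "Suc n \<le> m" by linarith
    then show False
    proof cases
      case 1
      then have "ereal t < ereal t"
        using jump_time_mono[of "Suc m" n x] that(2) assms(1) by (meson less_le_trans)
      then show ?thesis by simp
    next
      case 2
      then have "ereal t < ereal t"
        using jump_time_mono[of "Suc n" m x] that(1) assms(2) by (meson less_le_trans)
      then show ?thesis by simp
    qed
  qed
  then have "(THE m. jump_time x m \<le> ereal t \<and> ereal t < jump_time x (Suc m)) = n"
    using assms by (intro the_equality conjI) blast+
  then show ?thesis unfolding impulsive_semiflow_def by simp
qed

lemma impulsive_before_hit: "0 \<le> t \<Longrightarrow> ereal t < \<tau> x \<Longrightarrow> F t x = \<phi> t x"
  using impulsive_semiflow_eq[of x 0 t] by (simp add: jump_time_Suc)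

text \<open>The definition looks up the last impulse before t; the shift lemmas peel off the first
  one instead. This recursion, together with \<open>impulsive_before_hit\<close>, is all that is
  used of the definition later. At t = r the orbit has already jumped.\<close>

lemma impulsive_after_hit:
  assumes "\<tau> x = ereal r" "r \<le> t" shows "F t x = F (t - r) (I (\<phi> r x))"
proof -
  define x' where "x' = I (\<phi> r x)"
  have x': "I (hit_point \<phi> D x) = x'" using assms by (simp add: x'_def hit_point_def)
  obtain n where n: "jump_time x' n \<le> ereal (t - r)" "ereal (t - r) < jump_time x' (Suc n)"
    using ex_jump_index[of "t - r"] assms(2) by auto
  obtain s where s: "jump_time x' n = ereal s"
    using n(1) jump_time_nonneg[of x' n] by (cases "jump_time x' n") auto
  have "jump_time x (Suc m) = ereal r + jump_time x' m" for m
    using jump_time_Suc_shift x' assms by simp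
  moreover have "ereal t < ereal r + jump_time x' (Suc n)"
    using n(2) by (cases "jump_time x' (Suc n)") auto
  moreover have "ereal r + jump_time x' n \<le> ereal t" using n(1) s by simp
  ultimately have "jump_time x (Suc n) \<le> ereal t" "ereal t < jump_time x (Suc (Suc n))"
    "real_of_ereal (jump_time x (Suc n)) = r + real_of_ereal (jump_time x' n)"
    using s by auto
  from impulsive_semiflow_eq[OF this(1,2)] this(3)
  have "F t x = \<phi> (t - r - real_of_ereal (jump_time x' n)) (restart_point \<phi> D I x' n)"
    by (simp only: restart_point_Suc_shift x' diff_diff_eq)
  also have "\<dots> = F (t - r) x'" using impulsive_semiflow_eq[OF n] by (rule sym)
  finally show ?thesis by (simp only: x'_def)
qed

text \<open>Induction on the number of impulses up to time t, finite because the impulse times are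
  unbounded. The starting point and the time vary together: one impulse moves x to I (\<phi> r x)
  and t to t - r.\<close>

lemma impulsive_induct [consumes 1, case_names flow jump]:
  assumes "0 \<le> t"
    and flow: "\<And>t x. 0 \<le> t \<Longrightarrow> ereal t < \<tau> x \<Longrightarrow> P t x"
    and jump: "\<And>t x r. 0 < r \<Longrightarrow> \<tau> x = ereal r \<Longrightarrow> r \<le> t \<Longrightarrow> \<phi> r x \<in> D \<Longrightarrow>
      P (t - r) (I (\<phi> r x)) \<Longrightarrow> P t x"
  shows "P t x"
proof -
  obtain n where "ereal t < jump_time x (Suc n)" using ex_jump_time_greater by blast
  then show ?thesis using \<open>0 \<le> t\<close>
  proof (induction n arbitrary: t x)
    case 0
    then show ?case using flow by (simp add: jump_time_Suc)
  next
    case (Suc n)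
    show ?case
    proof (cases "ereal t < \<tau> x")
      case False
      then obtain r where r: "0 < r" "\<tau> x = ereal r" by (cases x rule: first_hit_cases) auto
      have "ereal t < ereal r + jump_time (I (\<phi> r x)) (Suc n)"
        using Suc.prems(1) r by (simp add: jump_time_Suc_shift hit_point_def)
      then have "ereal (t - r) < jump_time (I (\<phi> r x)) (Suc n)"
        by (cases "jump_time (I (\<phi> r x)) (Suc n)") auto
      moreover have "r \<le> t" using False r(2) by simp
      ultimately have "P (t - r) (I (\<phi> r x))" using Suc.IH by simp
      then show ?thesis using jump[OF r \<open>r \<le> t\<close> flow_first_hit[OF r(2)]] by blast
    qed (use flow Suc.prems in auto)
  qed
qed

lemma impulsive_0 [simp]: "F 0 x = x"
  using impulsive_before_hit[of 0 x] first_hit_pos[of x] by (simp add: zero_ereal_def)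

lemma impulsive_add:
  assumes "0 \<le> t" "0 \<le> s" shows "F (s + t) x = F s (F t x)"
  using assms(1)
proof (induction t x rule: impulsive_induct)
  case (flow t x)
  have eq: "\<tau> x = \<tau> (\<phi> t x) + ereal t" using first_hit_flow flow by blast
  show ?case
  proof (cases "\<phi> t x" rule: first_hit_cases)
    case infinite
    then show ?thesis using flow eq assms(2) by (simp add: impulsive_before_hit flow_add)
  next
    case (finite r)
    have \<tau>: "\<tau> x = ereal (r + t)" using finite eq by simp
    show ?thesis
    proof (cases "s < r")
      case True
      then show ?thesis using flow \<tau> finite assms(2) by (simp add: impulsive_before_hit flow_add)
    next
      case False
      then show ?thesis using flow finite assms(2) impulsive_after_hit[OF \<tau>]
        impulsive_after_hit[OF finite(2)] by (simp add: impulsive_before_hit flow_add)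
    qed
  qed
next
  case (jump t x r)
  have "F (s + t) x = F (s + t - r) (I (\<phi> r x))"
    using impulsive_after_hit[OF jump(2)] jump(3) assms(2) by simp
  then show ?case using jump impulsive_after_hit[OF jump(2,3)] by (simp add: algebra_simps)
qed

end


section \<open>The tube behind the impulse set\<close>

locale impulsive_tube = impulsive \<phi> D I
  for \<phi> :: "real \<Rightarrow> 'a::metric_space \<Rightarrow> 'a" and D :: "'a set" and I :: "'a \<Rightarrow> 'a" +
  fixes \<xi> :: real
  assumes compact_UNIV: "compact (UNIV :: 'a set)"
    and \<xi>_pos: "0 < \<xi>"
    and open_tube: "open (tube \<phi> D \<xi>)"
    and flow_tube_subset: "\<phi> \<xi> ` tube \<phi> D \<xi> \<subseteq> off_tube \<phi> D \<xi>"
begin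

abbreviation U :: "'a set" where "U \<equiv> tube \<phi> D \<xi>"

abbreviation S :: "'a set" where "S \<equiv> off_tube \<phi> D \<xi>"

lemma compact_D: "compact D"
  using closed_D compact_UNIV by (metis compact_Int_closed inf_top_left)

lemma mem_tube: "x \<in> tube \<phi> D a \<longleftrightarrow> (\<exists>z\<in>D. \<exists>t. 0 < t \<and> t < a \<and> x = \<phi> t z)"
  unfolding tube_def by auto

lemma closed_Compl_U: "closed (- U)"
  using open_tube by (simp add: closed_def)

lemma mem_S: "x \<in> S \<longleftrightarrow> x \<notin> D \<and> x \<notin> U"
  unfolding off_tube_def by auto

lemma flow_mem_U: "z \<in> D \<Longrightarrow> 0 < t \<Longrightarrow> t < \<xi> \<Longrightarrow> \<phi> t z \<in> U"
  unfolding mem_tube by blast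

lemma flow_after_\<xi>: assumes "z \<in> D" "0 < s" "s < \<xi>" shows "\<phi> (\<xi> + s) z \<in> S"
proof -
  have "\<phi> s z \<in> U" using flow_mem_U assms .
  then have "\<phi> \<xi> (\<phi> s z) \<in> S" using flow_tube_subset by blast
  then show ?thesis using assms(2) \<xi>_pos by (simp add: flow_add)
qed

text \<open>A return to D at a time t < \<xi> would start a new tube. The point at time \<xi> + t/2
  would have level \<xi> - t/2 in it, although \<open>flow_after_\<xi>\<close> places that point in
  \<open>S\<close>.\<close>

lemma D_Int_U: "D \<inter> U = {}"
proof (rule ccontr)
  assume "D \<inter> U \<noteq> {}"
  then obtain z t where z: "z \<in> D" "0 < t" "t < \<xi>" "\<phi> t z \<in> D" by (auto simp: mem_tube)
  have "\<phi> (\<xi> - t / 2) (\<phi> t z) \<in> U" using z by (intro flow_mem_U) auto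
  moreover have "\<phi> (\<xi> - t / 2) (\<phi> t z) = \<phi> (\<xi> + t / 2) z"
    using z flow_diff[of t "\<xi> + t / 2" z] by simp
  moreover have "\<phi> (\<xi> + t / 2) z \<in> S" using z by (intro flow_after_\<xi>) auto
  ultimately show False by (simp add: mem_S)
qed

text \<open>The regularity inclusion speaks only of levels strictly above \<xi>. Level \<xi> is
  their limit, which stays outside the open set \<open>U\<close>; it is not in D, since a new tube
  would begin there.\<close>

lemma flow_\<xi>: assumes "z \<in> D" shows "\<phi> \<xi> z \<in> S"
proof -
  have "\<phi> \<xi> z \<notin> D"
  proof
    assume *: "\<phi> \<xi> z \<in> D"
    have "\<phi> (\<xi> / 2) (\<phi> \<xi> z) \<in> U" using * \<xi>_pos by (intro flow_mem_U) auto
    moreover have "\<phi> (\<xi> / 2) (\<phi> \<xi> z) = \<phi> (\<xi> + \<xi> / 2) z"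
      using \<xi>_pos flow_diff[of \<xi> "\<xi> + \<xi> / 2" z] by simp
    moreover have "\<phi> (\<xi> + \<xi> / 2) z \<in> S" using assms \<xi>_pos by (intro flow_after_\<xi>) auto
    ultimately show False by (simp add: mem_S)
  qed
  moreover have "\<phi> \<xi> z \<in> - U"
  proof (rule closed_sequentially[of "- U" "\<lambda>n. \<phi> (\<xi> + \<xi> / real (Suc (Suc n))) z"])
    show "closed (- U)" by (rule closed_Compl_U)
    show "\<phi> (\<xi> + \<xi> / real (Suc (Suc n))) z \<in> - U" for n
      using flow_after_\<xi>[OF assms, of "\<xi> / real (Suc (Suc n))"] \<xi>_pos
      by (simp add: mem_S field_simps del: of_nat_Suc)
    have "(\<lambda>n. 1 / real (Suc (Suc n))) \<longlonglongrightarrow> 0" by (intro LIMSEQ_Suc lim_1_over_n)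
    from tendsto_add[OF tendsto_const tendsto_mult[OF tendsto_const this], of \<xi> \<xi>]
    have "(\<lambda>n. \<xi> + \<xi> / real (Suc (Suc n))) \<longlonglongrightarrow> \<xi>" by simp
    then show "(\<lambda>n. \<phi> (\<xi> + \<xi> / real (Suc (Suc n))) z) \<longlonglongrightarrow> \<phi> \<xi> z"
      using \<xi>_pos by (intro flow_tendsto) auto
  qed
  ultimately show ?thesis by (simp add: mem_S)
qed

lemma flow_leaves_tube: "z \<in> D \<Longrightarrow> \<xi> \<le> s \<Longrightarrow> s < 2 * \<xi> \<Longrightarrow> \<phi> s z \<in> S"
  using flow_after_\<xi>[of z "s - \<xi>"] flow_\<xi>[of z] by (cases "s = \<xi>") auto

lemma flow_mem_D_Un_U: "z \<in> D \<Longrightarrow> 0 \<le> t \<Longrightarrow> t < \<xi> \<Longrightarrow> \<phi> t z \<in> D \<union> U"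
  using flow_mem_U[of z t] by (cases "t = 0") auto

text \<open>The substitute for backward uniqueness: advancing a common point by \<xi> - a would lead
  to \<phi> \<xi> x, which lies in \<open>S\<close>, and also to a point of level \<xi> - a + b <
  \<xi>, which lies in D or \<open>U\<close>.\<close>

lemma tube_level_unique:
  assumes "x \<in> D" "z \<in> D" "0 \<le> b" "b < a" "a \<le> \<xi>" shows "\<phi> a x \<noteq> \<phi> b z"
proof
  assume eq: "\<phi> a x = \<phi> b z"
  have "\<phi> \<xi> x = \<phi> (\<xi> - a) (\<phi> b z)" using flow_diff[of a \<xi> x] assms eq by simp
  also have "\<dots> = \<phi> (\<xi> - a + b) z" using assms by (simp add: flow_add)
  finally have "\<phi> \<xi> x = \<phi> (\<xi> - a + b) z" .
  moreover have "\<phi> (\<xi> - a + b) z \<in> D \<union> U" using assms by (intro flow_mem_D_Un_U) auto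
  ultimately show False using flow_\<xi>[OF assms(1)] by (auto simp: mem_S)
qed

lemma compact_flow_image:
  assumes "0 \<le> a" shows "compact ((\<lambda>(t, x). \<phi> t x) ` ({a..b} \<times> D))"
  using assms by (intro compact_continuous_image continuous_on_subset[OF continuous_flow]
      compact_Times compact_Icc compact_D) auto

text \<open>Let u be the last time outside \<open>U\<close>. As a limit of tube points, \<phi> u y
  has some level r in [0,\<xi>]. If r were strictly between the ends, the point would lie in
  \<open>U\<close>; if r were \<xi>, the orbit would be in \<open>S\<close> just after u. Hence r =
  0, a point of D.\<close>

lemma enters_tube_through_D:
  assumes "y \<notin> U" "0 \<le> w" "\<phi> w y \<in> U" obtains u where "0 \<le> u" "u < w" "\<phi> u y \<in> D"
proof -
  have cont: "continuous_on {0..w} (\<lambda>v. \<phi> v y)"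
    using continuous_on_compose[of "{0..w}" "\<lambda>v. (v, y)" "\<lambda>(t, x). \<phi> t x"]
      continuous_on_subset[OF continuous_flow, of "(\<lambda>v. (v, y)) ` {0..w}"]
    by (force simp: o_def intro: continuous_on_Pair continuous_on_id continuous_on_const)
  define A where "A = {0..w} \<inter> (\<lambda>v. \<phi> v y) -` (- U)"
  have "closed A"
    unfolding A_def using continuous_closed_preimage[OF cont] closed_Compl_U by auto
  then have "compact A"
    unfolding A_def by (metis bounded_Int bounded_closed_interval compact_eq_bounded_closed
        cbox_interval bounded_cbox)
  moreover have "A \<noteq> {}" using assms by (auto simp: A_def)
  ultimately obtain u where "u \<in> A" "\<forall>v\<in>A. v \<le> u"
    using compact_attains_sup by meson
  then have u: "u \<in> {0..w}" "\<phi> u y \<notin> U" "\<And>v. v \<in> {0..w} \<Longrightarrow> \<phi> v y \<notin> U \<Longrightarrow> v \<le> u"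
    by (auto simp: A_def)
  then have "u < w" using assms(3) by (cases "u = w") auto
  have inU: "\<phi> v y \<in> U" if "u < v" "v \<le> w" for v using u(1) u(3)[of v] that by force
  let ?C = "(\<lambda>(t, x). \<phi> t x) ` ({0..\<xi>} \<times> D)"
  let ?v = "\<lambda>n. u + (w - u) / real (Suc n)"
  have "\<phi> u y \<in> ?C"
  proof (rule closed_sequentially[of ?C "\<lambda>n. \<phi> (?v n) y"])
    show "closed ?C" using compact_flow_image[of 0 \<xi>] compact_imp_closed by simp
    show "\<phi> (?v n) y \<in> ?C" for n
    proof -
      have "\<phi> (?v n) y \<in> U"
        using \<open>u < w\<close> by (intro inU) (auto simp: field_simps mult_right_mono)
      then obtain z t where "z \<in> D" "0 < t" "t < \<xi>" "\<phi> (?v n) y = \<phi> t z"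
        unfolding mem_tube by blast
      then show ?thesis by (force simp: image_iff)
    qed
    have "?v \<longlonglongrightarrow> u"
      using tendsto_add[OF tendsto_const tendsto_mult[OF tendsto_const LIMSEQ_Suc[OF lim_1_over_n]],
          of u "w - u"] by simp
    then show "(\<lambda>n. \<phi> (?v n) y) \<longlonglongrightarrow> \<phi> u y"
      using u(1) \<open>u < w\<close> by (intro flow_tendsto) auto
  qed
  then obtain r z where r: "0 \<le> r" "r \<le> \<xi>" "z \<in> D" "\<phi> u y = \<phi> r z" by auto
  have "r \<noteq> \<xi>"
  proof
    assume "r = \<xi>"
    \<comment> \<open>The bound by w - u keeps the orbit of y in \<open>U\<close> at time u + c, and
      the bound by \<xi>/2 lets \<open>flow_after_\<xi>\<close> apply to z.\<close>
    define c where "c = min (w - u) (\<xi> / 2)"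
    have c: "0 < c" "c \<le> w - u" "c < \<xi>" using \<open>u < w\<close> \<xi>_pos by (auto simp: c_def)
    have "\<phi> (c + u) y = \<phi> (c + \<xi>) z"
      using r u(1) c \<open>r = \<xi>\<close> by (simp add: flow_add)
    moreover have "\<phi> (c + \<xi>) z \<in> S" using flow_after_\<xi>[of z c] r c by (simp add: add.commute)
    moreover have "\<phi> (c + u) y \<in> U" using c by (intro inU) auto
    ultimately show False by (simp add: mem_S)
  qed
  moreover have "\<not> (0 < r \<and> r < \<xi>)" using flow_mem_U r u(2) by metis
  ultimately have "r = 0" using r by linarith
  then show thesis using that[of u] r u(1) \<open>u < w\<close> by simp
qed

text \<open>Points of level at least \<zeta> form a compact set, and uniqueness of levels shows that
  removing it from \<open>U\<close> leaves exactly the shorter tube. Uniqueness also yields the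
  inclusion, since a point of level \<zeta> + t > \<zeta> has no second level below \<zeta>.\<close>

lemma shorter_tube:
  assumes "0 < \<zeta>" "\<zeta> \<le> \<xi> / 2"
  shows "open (tube \<phi> D \<zeta>)" "\<phi> \<zeta> ` tube \<phi> D \<zeta> \<subseteq> off_tube \<phi> D \<zeta>"
proof -
  have "- tube \<phi> D \<zeta> = - U \<union> (\<lambda>(t, x). \<phi> t x) ` ({\<zeta>..\<xi>} \<times> D)"
  proof (intro antisym subsetI)
    fix x assume x: "x \<in> - tube \<phi> D \<zeta>"
    show "x \<in> - U \<union> (\<lambda>(t, x). \<phi> t x) ` ({\<zeta>..\<xi>} \<times> D)"
    proof (cases "x \<in> U")
      case True
      then obtain z t where zt: "z \<in> D" "0 < t" "t < \<xi>" "x = \<phi> t z" unfolding mem_tube by blast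
      then have "\<zeta> \<le> t" using x unfolding Compl_iff mem_tube by force
      then have "(t, z) \<in> {\<zeta>..\<xi>} \<times> D" using zt by simp
      then show ?thesis using zt(4) by force
    qed simp
  next
    fix x assume x: "x \<in> - U \<union> (\<lambda>(t, x). \<phi> t x) ` ({\<zeta>..\<xi>} \<times> D)"
    show "x \<in> - tube \<phi> D \<zeta>"
    proof
      assume "x \<in> tube \<phi> D \<zeta>"
      then obtain z t where z: "z \<in> D" "0 < t" "t < \<zeta>" "x = \<phi> t z" unfolding mem_tube by blast
      then have "x \<in> U" using assms \<xi>_pos flow_mem_U[of z t] by simp
      then obtain y s where "y \<in> D" "\<zeta> \<le> s" "s \<le> \<xi>" "x = \<phi> s y" using x by auto
      then show False using tube_level_unique[of y z t s] z by auto
    qed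
  qed
  moreover have "closed (- U \<union> (\<lambda>(t, x). \<phi> t x) ` ({\<zeta>..\<xi>} \<times> D))"
    using closed_Compl_U compact_flow_image[of \<zeta> \<xi>] assms(1) by (auto intro!: closed_Un compact_imp_closed[of "(\<lambda>(t, x). \<phi> t x) ` _"])
  ultimately show "open (tube \<phi> D \<zeta>)" by (simp add: open_closed)
  show "\<phi> \<zeta> ` tube \<phi> D \<zeta> \<subseteq> off_tube \<phi> D \<zeta>"
  proof
    fix x assume "x \<in> \<phi> \<zeta> ` tube \<phi> D \<zeta>"
    then obtain z t where z: "z \<in> D" "0 < t" "t < \<zeta>" "x = \<phi> \<zeta> (\<phi> t z)" by (auto simp: mem_tube)
    then have x: "x = \<phi> (\<zeta> + t) z" using assms by (simp add: flow_add)
    \<comment> \<open>The bound \<zeta> \<le> \<xi>/2 keeps \<zeta> + t within the range of unique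
      levels. The case s = 0 excludes D itself.\<close>
    have "x \<noteq> \<phi> s y" if "y \<in> D" "0 \<le> s" "s < \<zeta>" for y s
      unfolding x using z that assms by (intro tube_level_unique) auto
    then show "x \<in> off_tube \<phi> D \<zeta>"
      unfolding off_tube_def using assms(1) flow_0 mem_tube by (metis DiffI UNIV_I UnE less_imp_le order_refl)
  qed
qed

lemma compact_impulse_image: "compact (I ` D)"
  using compact_D impulsive_system by (intro compact_continuous_image) (auto simp: impulsive_system_def)

text \<open>Tubes whose length tends to 0 shrink to D. If all of them met the compact set I(D), a
  limit point would lie both in D and in I(D).\<close>

lemma tube_avoids_impulse_image:
  assumes "I ` D \<inter> D = {}"
  shows "\<exists>\<zeta>. 0 < \<zeta> \<and> \<zeta> \<le> \<xi> / 2 \<and> I ` D \<inter> tube \<phi> D \<zeta> = {}"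
proof (rule ccontr)
  \<comment> \<open>Dividing by n + 2 makes already the first length at most \<xi>/2.\<close>
  let ?a = "\<lambda>n. \<xi> / real (Suc (Suc n))"
  assume contra: "\<not> ?thesis"
  have "\<exists>t z. z \<in> D \<and> 0 < t \<and> t < ?a n \<and> \<phi> t z \<in> I ` D" for n
  proof -
    have "0 < ?a n" "?a n \<le> \<xi> / 2" using \<xi>_pos by (auto simp: field_simps)
    then obtain x where "x \<in> I ` D" "x \<in> tube \<phi> D (?a n)" using contra by blast
    moreover from this(2) obtain z t where "z \<in> D" "0 < t" "t < ?a n" "x = \<phi> t z"
      unfolding mem_tube by blast
    ultimately show ?thesis by (intro exI[of _ t] exI[of _ z]) simp
  qed
  then obtain t z where tz: "\<And>n. z n \<in> D" "\<And>n. 0 < t n" "\<And>n. t n < ?a n" "\<And>n. \<phi> (t n) (z n) \<in> I ` D"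
    by metis
  obtain l r where l: "l \<in> D" "strict_mono (r :: nat \<Rightarrow> nat)" "(z \<circ> r) \<longlonglongrightarrow> l"
    using compact_imp_seq_compact[OF compact_D] tz(1) unfolding seq_compact_def by metis
  have "(\<lambda>n. 1 / real (Suc (Suc n))) \<longlonglongrightarrow> 0" by (intro LIMSEQ_Suc lim_1_over_n)
  from tendsto_mult[OF tendsto_const this, of \<xi>] have "?a \<longlonglongrightarrow> 0" by simp
  then have "t \<longlonglongrightarrow> 0"
    using tendsto_sandwich[of "\<lambda>_. 0" t sequentially ?a 0] tz by (simp add: less_imp_le)
  then have "(t \<circ> r) \<longlonglongrightarrow> 0" using l(2) LIMSEQ_subseq_LIMSEQ by blast
  from flow_tendsto[OF this l(3)] have "(\<lambda>n. \<phi> ((t \<circ> r) n) ((z \<circ> r) n)) \<longlonglongrightarrow> l"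
    using tz(2) by (simp add: less_imp_le)
  then have "l \<in> I ` D"
    using closed_sequentially[OF compact_imp_closed[OF compact_impulse_image],
        of "\<lambda>n. \<phi> ((t \<circ> r) n) ((z \<circ> r) n)"] tz(4) by simp
  then show False using l(1) assms by blast
qed

end

locale impulsive_regular = impulsive_tube +
  fixes L :: real
  assumes impulse_image_disjoint: "I ` D \<inter> D = {}" "I ` D \<inter> tube \<phi> D \<xi> = {}"
    and lipschitz_impulse: "L-lipschitz_on D I"
begin

lemma impulse_mem_S: "z \<in> D \<Longrightarrow> I z \<in> S"
  using impulse_image_disjoint by (auto simp: mem_S)

lemma flow_mem_S: assumes "x \<in> S" "0 \<le> t" "ereal t < \<tau> x" shows "\<phi> t x \<in> S"
proof -
  have noD: "\<phi> u x \<notin> D" if "0 \<le> u" "u \<le> t" for u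
  proof (cases "u = 0")
    case False
    moreover have "ereal u < \<tau> x" using assms(3) that(2) le_less_trans[of "ereal u" "ereal t"] by simp
    ultimately show ?thesis using less_first_hit[of u x] that by simp
  qed (use assms(1) mem_S in simp)
  moreover have "\<phi> t x \<notin> U"
  proof
    assume "\<phi> t x \<in> U"
    moreover have "x \<notin> U" using assms(1) by (simp add: mem_S)
    ultimately obtain u where "0 \<le> u" "u < t" "\<phi> u x \<in> D"
      using enters_tube_through_D assms(2) by blast
    then show False using noD by force
  qed
  ultimately show ?thesis using assms(2) by (simp add: mem_S)
qed

lemma impulsive_mem_S: assumes "0 \<le> t" "x \<in> S" shows "F t x \<in> S"
  using assms
proof (induction t x rule: impulsive_induct)
  case (flow t x)
  then show ?case using flow_mem_S by (simp add: impulsive_before_hit)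
next
  case (jump t x r)
  then show ?case using impulse_mem_S impulsive_after_hit by simp
qed

text \<open>A point of level r < \<xi> meets D only at a level of at least 2 * \<xi>: lower positive
  levels lie in \<open>U\<close> or in \<open>S\<close>. The first impulse therefore comes after
  more than \<xi>.\<close>

lemma impulsive_tube_eq:
  assumes "x \<in> D \<union> U" "0 \<le> t" "t \<le> \<xi>" shows "F t x = \<phi> t x"
proof -
  obtain z r where z: "z \<in> D" "0 \<le> r" "r < \<xi>" "x = \<phi> r z"
    using assms(1) \<xi>_pos unfolding Un_iff mem_tube by (metis flow_0 less_imp_le order_refl)
  have "ereal t < \<tau> x"
  proof (cases x rule: first_hit_cases)
    case (finite h)
    have "\<phi> (h + r) z \<in> D" using flow_first_hit[OF finite(2)] z finite(1) by (simp add: flow_add)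
    then have "\<not> h + r < \<xi>" "\<not> (\<xi> \<le> h + r \<and> h + r < 2 * \<xi>)"
      using flow_mem_U[of z "h + r"] flow_leaves_tube[of z "h + r"] z finite(1) D_Int_U mem_S by auto
    then show ?thesis using finite z assms by simp
  qed simp
  then show ?thesis using impulsive_before_hit assms(2) by simp
qed

text \<open>A point outside \<open>S\<close> has a level r < \<xi>. It flows without impulse to
  level \<xi> + r, which lies between \<xi> and 2 * \<xi> and hence in \<open>S\<close>.\<close>

lemma impulsive_\<xi>_mem_S: "F \<xi> x \<in> S"
proof (cases "x \<in> S")
  case False
  then obtain z r where z: "z \<in> D" "0 \<le> r" "r < \<xi>" "x = \<phi> r z"
    using \<xi>_pos unfolding mem_S mem_tube by (metis flow_0 less_imp_le order_refl)
  have "F \<xi> x = \<phi> (\<xi> + r) z"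
    using impulsive_tube_eq[of x \<xi>] False \<xi>_pos z by (auto simp: mem_S flow_add)
  then show ?thesis using flow_leaves_tube[of z "\<xi> + r"] z by simp
qed (use impulsive_mem_S \<xi>_pos in simp)

section \<open>Continuity of the hitting time along sequences in X_\<xi>\<close>

lemma not_mem_U_limit:
  assumes "\<And>n. x n \<in> S" "x \<longlonglongrightarrow> z" shows "z \<notin> U"
proof -
  have "z \<in> - U" using closed_sequentially[OF closed_Compl_U, of x z] assms by (simp add: mem_S)
  then show ?thesis by simp
qed

text \<open>Lower semicontinuity of the hitting time outside D: bounded hitting times accumulate at
  some l \<le> t0 with \<phi> l z in D, and l > 0 because z is not in D.\<close>

lemma eventually_before_hit:
  assumes x: "x \<longlonglongrightarrow> z" and "z \<notin> D" and t: "t \<longlonglongrightarrow> t0" and "ereal t0 < \<tau> z"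
  shows "\<forall>\<^sub>F n in sequentially. ereal (t n) < \<tau> (x n)"
proof (rule ccontr)
  assume "\<not> ?thesis"
  from not_eventually_sequentiallyD[OF this] obtain r where r: "strict_mono (r :: nat \<Rightarrow> nat)"
    "\<And>n. \<tau> (x (r n)) \<le> ereal (t (r n))" by (auto simp: not_less)
  define h where "h n = real_of_ereal (\<tau> (x (r n)))" for n
  have h: "0 < h n" "\<tau> (x (r n)) = ereal (h n)" "h n \<le> t (r n)" for n
    using r(2)[of n] by (cases "x (r n)" rule: first_hit_cases; simp add: h_def)+
  have tr: "(\<lambda>n. t (r n)) \<longlonglongrightarrow> t0" using LIMSEQ_subseq_LIMSEQ[OF t r(1)] by (simp add: o_def)
  obtain B where B: "\<And>n. t (r n) \<le> B"
    using convergent_imp_Bseq[OF convergentI[OF tr]] by (metis BseqE abs_le_D1 real_norm_def)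
  have "\<forall>n. h n \<in> {0..B}" using h B by (meson atLeastAtMost_iff less_imp_le order_trans)
  then obtain l q where l: "l \<in> {0..B}" "strict_mono (q :: nat \<Rightarrow> nat)" "(h \<circ> q) \<longlonglongrightarrow> l"
    using compact_imp_seq_compact[OF compact_Icc, of 0 B] unfolding seq_compact_def by metis
  have "l \<le> t0"
    by (rule LIMSEQ_le[OF l(3) LIMSEQ_subseq_LIMSEQ[OF tr l(2)]]) (use h in auto)
  have "(x \<circ> (r \<circ> q)) \<longlonglongrightarrow> z" using LIMSEQ_subseq_LIMSEQ[OF x] strict_mono_o r(1) l(2) by blast
  then have "(\<lambda>n. \<phi> ((h \<circ> q) n) ((x \<circ> (r \<circ> q)) n)) \<longlonglongrightarrow> \<phi> l z"
    using flow_tendsto[OF l(3) \<open>(x \<circ> (r \<circ> q)) \<longlonglongrightarrow> z\<close>] l(1) h(1) by (simp add: less_imp_le)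
  then have "\<phi> l z \<in> D"
    using closed_sequentially[OF closed_D, of "\<lambda>n. \<phi> ((h \<circ> q) n) ((x \<circ> (r \<circ> q)) n)"]
      flow_first_hit[OF h(2)] by simp
  moreover have "0 < l" using l(1) \<open>\<phi> l z \<in> D\<close> \<open>z \<notin> D\<close> by (cases "l = 0") auto
  ultimately have "\<tau> z \<le> ereal l" by (simp add: first_hit_le)
  then show False using \<open>l \<le> t0\<close> assms(4) by (meson ereal_less_eq(3) leD le_less_trans)
qed

text \<open>Upper semicontinuity: shortly after time r the orbit of z is in the open tube, hence so
  are the orbits of nearby points. Those starting in \<open>S\<close> must have crossed D to get
  there.\<close>

lemma eventually_after_hit:
  assumes "\<And>n. x n \<in> S" "x \<longlonglongrightarrow> z" "0 \<le> r" "\<phi> r z \<in> D" "r < s"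
  shows "\<forall>\<^sub>F n in sequentially. \<tau> (x n) < ereal s"
proof -
  \<comment> \<open>The cap \<xi>/2 ensures that \<phi> r z, flowing for s' - r, is still in its
    tube.\<close>
  define s' where "s' = r + min (s - r) (\<xi> / 2)"
  have s': "r < s'" "s' \<le> s" "s' < r + \<xi>" using assms(5) \<xi>_pos by (auto simp: s'_def)
  have "\<phi> (s' - r) (\<phi> r z) \<in> U" using s' assms(4) by (intro flow_mem_U) auto
  then have "\<phi> s' z \<in> U" using flow_diff[of r s' z] s' assms(3) by simp
  moreover have "(\<lambda>n. \<phi> s' (x n)) \<longlonglongrightarrow> \<phi> s' z"
    using assms(2,3) s' by (intro flow_tendsto) auto
  ultimately have "\<forall>\<^sub>F n in sequentially. \<phi> s' (x n) \<in> U" using open_tube topological_tendstoD by blast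
  then show ?thesis
  proof eventually_elim
    case (elim n)
    have "x n \<notin> U" "x n \<notin> D" using assms(1)[of n] by (auto simp: mem_S)
    then obtain u where u: "0 \<le> u" "u < s'" "\<phi> u (x n) \<in> D"
      using enters_tube_through_D[of "x n" s'] elim s' assms(3) by auto
    then have "0 < u" using \<open>x n \<notin> D\<close> by (cases "u = 0") auto
    then show ?case using first_hit_le[of u "x n"] u s' by (meson ereal_less(2) le_less_trans less_le_trans ereal_less_le less_ereal.simps(1))
  qed
qed

text \<open>Here r is the first visit of z to D with time 0 included. For z in D the limit is thus
  0, whereas the hitting time of z itself is positive; this is why the limit is not written as
  \<open>\<tau> z\<close>.\<close>

lemma first_hit_tendsto:
  assumes "\<And>n. x n \<in> S" "x \<longlonglongrightarrow> z" "0 \<le> r" "\<phi> r z \<in> D" "\<And>u. 0 \<le> u \<Longrightarrow> u < r \<Longrightarrow> \<phi> u z \<notin> D"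
  shows "(\<lambda>n. real_of_ereal (\<tau> (x n))) \<longlonglongrightarrow> r"
    "\<forall>\<^sub>F n in sequentially. \<tau> (x n) = ereal (real_of_ereal (\<tau> (x n)))"
proof -
  have "\<forall>\<^sub>F n in sequentially. \<tau> (x n) < ereal (r + 1)"
    using assms by (intro eventually_after_hit[of x z r]) auto
  then show ev: "\<forall>\<^sub>F n in sequentially. \<tau> (x n) = ereal (real_of_ereal (\<tau> (x n)))"
  proof eventually_elim
    case (elim n) then show ?case by (cases "x n" rule: first_hit_cases) auto
  qed
  show "(\<lambda>n. real_of_ereal (\<tau> (x n))) \<longlonglongrightarrow> r"
  proof (rule order_tendstoI)
    fix a assume "r < a"
    with assms have "\<forall>\<^sub>F n in sequentially. \<tau> (x n) < ereal a" by (intro eventually_after_hit[of x z r])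
    with ev show "\<forall>\<^sub>F n in sequentially. real_of_ereal (\<tau> (x n)) < a"
      by eventually_elim (metis less_ereal.simps(1))
  next
    fix a assume "a < r"
    show "\<forall>\<^sub>F n in sequentially. a < real_of_ereal (\<tau> (x n))"
    proof (cases "a < 0")
      case True
      show ?thesis
        by (intro always_eventually allI less_le_trans[OF True] real_of_ereal_pos less_imp_le first_hit_pos)
    next
      case False
      then have "z \<notin> D" using assms(5)[of 0] \<open>a < r\<close> by simp
      moreover have "ereal a < \<tau> z"
      proof (rule ccontr)
        assume "\<not> ereal a < \<tau> z"
        then obtain h where "0 < h" "\<tau> z = ereal h" "h \<le> a"
          by (cases z rule: first_hit_cases) auto
        then show False using flow_first_hit[of z h] assms(5)[of h] \<open>a < r\<close> by simp
      qed
      ultimately have "\<forall>\<^sub>F n in sequentially. ereal a < \<tau> (x n)"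
        using eventually_before_hit[OF assms(2), of "\<lambda>_. a" a] by simp
      with ev show ?thesis by eventually_elim (metis less_ereal.simps(1))
    qed
  qed
qed

text \<open>The hitting time is positive and lower semicontinuous on I(D), which is compact and
  disjoint from D. The bound leaves at most one impulse to treat in a short time window.\<close>

lemma ex_hit_gap: "\<exists>\<beta>>0. \<forall>z\<in>D. ereal \<beta> < \<tau> (I z)"
proof (rule ccontr)
  assume contra: "\<not> ?thesis"
  have "\<exists>z\<in>D. \<tau> (I z) \<le> ereal (1 / real (Suc n))" for n
  proof -
    have "0 < 1 / real (Suc n)" by simp
    then show ?thesis using contra by (meson not_less)
  qed
  then obtain z where z: "\<And>n. z n \<in> D" "\<And>n. \<tau> (I (z n)) \<le> ereal (1 / real (Suc n))" by metis
  obtain l r where l: "l \<in> D" "strict_mono (r :: nat \<Rightarrow> nat)" "(z \<circ> r) \<longlonglongrightarrow> l"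
    using compact_imp_seq_compact[OF compact_D] z(1) unfolding seq_compact_def by metis
  have "(\<lambda>n. I ((z \<circ> r) n)) \<longlonglongrightarrow> I l"
    using continuous_on_tendsto_compose[OF lipschitz_on_continuous_on[OF lipschitz_impulse] l(3,1)] z(1)
    by simp
  moreover have "(\<lambda>n. 1 / real (Suc (r n))) \<longlonglongrightarrow> 0"
    using LIMSEQ_subseq_LIMSEQ[OF LIMSEQ_Suc[OF lim_1_over_n] l(2)] by (simp add: o_def)
  moreover have "I l \<notin> D" using l(1) impulse_image_disjoint by blast
  ultimately have "\<forall>\<^sub>F n in sequentially. ereal (1 / real (Suc (r n))) < \<tau> (I ((z \<circ> r) n))"
    using first_hit_pos[of "I l"] by (intro eventually_before_hit) (auto simp: zero_ereal_def)
  then show False using z(2) by (auto simp: eventually_sequentially) (meson leD order_refl)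
qed

end


section \<open>Glueing the impulse set to its image\<close>

lemma lipschitz_cone: "1-lipschitz_on UNIV (\<lambda>z. max 0 (\<rho> - dist x z))"
proof (rule lipschitz_onI)
  fix y z :: 'a
  have "\<bar>dist x y - dist x z\<bar> \<le> dist y z"
    using dist_triangle[of x y z] dist_triangle[of x z y] by (simp add: dist_commute)
  then show "dist (max 0 (\<rho> - dist x y)) (max 0 (\<rho> - dist x z)) \<le> 1 * dist y z"
    by (auto simp: dist_real_def max_def)
qed simp

text \<open>This is McShane's extension by the infimum of g c + dist z c; nonnegativity of g bounds
  the infimum from below.\<close>

lemma lipschitz_extension:
  fixes g :: "'a::metric_space \<Rightarrow> real"
  assumes lip: "\<And>c c'. c \<in> E \<Longrightarrow> c' \<in> E \<Longrightarrow> g c - g c' \<le> dist c c'"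
    and nonneg: "\<And>c. c \<in> E \<Longrightarrow> 0 \<le> g c" and "E \<noteq> {}"
  obtains h where "1-lipschitz_on UNIV h" "\<And>c. c \<in> E \<Longrightarrow> h c = g c"
proof
  define h where "h z = (INF c\<in>E. g c + dist z c)" for z
  have bdd: "bdd_below ((\<lambda>c. g c + dist z c) ` E)" for z
    using nonneg by (intro bdd_belowI[of _ 0]) auto
  have h_le: "h z \<le> h z' + dist z z'" for z z'
  proof -
    have "h z - dist z z' \<le> g c + dist z' c" if "c \<in> E" for c
      using cINF_lower[OF bdd[of z] that] dist_triangle[of z c z'] unfolding h_def by linarith
    then have "h z - dist z z' \<le> h z'"
      unfolding h_def[of z'] using \<open>E \<noteq> {}\<close> by (intro cINF_greatest) auto
    then show ?thesis by simp
  qed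
  show "1-lipschitz_on UNIV h"
  proof (rule lipschitz_onI)
    fix y z show "dist (h y) (h z) \<le> 1 * dist y z"
      using h_le[of y z] h_le[of z y] by (simp add: dist_real_def dist_commute abs_le_iff)
  qed simp
  show "h c = g c" if "c \<in> E" for c
  proof (rule antisym)
    show "h c \<le> g c" using cINF_lower[OF bdd[of c] that] unfolding h_def by simp
    have "g c \<le> g c' + dist c c'" if "c' \<in> E" for c' using lip[OF \<open>c \<in> E\<close> that] by simp
    then show "g c \<le> h c" unfolding h_def using \<open>E \<noteq> {}\<close> by (intro cINF_greatest) auto
  qed
qed

text \<open>
  The distance below is the Kantorovich dual form of the quotient pseudometric that identifies
  every \<open>c \<in> D\<close> with \<open>I c\<close>; the Lipschitz condition on \<open>I\<close> guarantees that it separates points.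
\<close>

locale glueing =
  fixes S D :: "'a::metric_space set" and I :: "'a \<Rightarrow> 'a" and L :: real
  assumes compact_D: "compact D" and disjoint: "S \<inter> D = {}" and image: "I ` D \<subseteq> S"
    and lipschitz: "L-lipschitz_on D I"
begin

text \<open>All points outside D are left fixed, also those outside \<open>S\<close>. The map is
  thus total, and \<open>glue_dist_proj_le\<close> holds without a restriction to \<open>S\<close>
  and D.\<close>

definition proj :: "'a \<Rightarrow> 'a" where "proj x = (if x \<in> D then I x else x)"

definition invariants :: "('a \<Rightarrow> real) set" where
  "invariants = {f. 1-lipschitz_on UNIV f \<and> (\<forall>c\<in>D. f (I c) = f c)}"

definition glue_dist :: "'a \<Rightarrow> 'a \<Rightarrow> real" where
  "glue_dist x y = (SUP f\<in>invariants. \<bar>f x - f y\<bar>)"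

lemma invariants_nonempty: "invariants \<noteq> {}"
proof -
  have "1-lipschitz_on UNIV (\<lambda>_::'a. 0::real)" by (intro lipschitz_onI) auto
  then show ?thesis unfolding invariants_def by blast
qed

lemma invariant_le_dist: "f \<in> invariants \<Longrightarrow> \<bar>f x - f y\<bar> \<le> dist x y"
  using lipschitz_onD[of 1 UNIV f x y] by (simp add: invariants_def dist_real_def)

lemma le_glue_dist: "f \<in> invariants \<Longrightarrow> \<bar>f x - f y\<bar> \<le> glue_dist x y"
  unfolding glue_dist_def
  by (rule cSUP_upper) (auto intro!: bdd_aboveI[of _ "dist x y"] invariant_le_dist)

lemma glue_dist_le: "(\<And>f. f \<in> invariants \<Longrightarrow> \<bar>f x - f y\<bar> \<le> a) \<Longrightarrow> glue_dist x y \<le> a"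
  unfolding glue_dist_def using invariants_nonempty by (rule cSUP_least)

lemma invariant_proj: "f \<in> invariants \<Longrightarrow> f (proj x) = f x"
  by (simp add: invariants_def proj_def)

lemma glue_dist_proj_le: "glue_dist (proj x) (proj y) \<le> dist x y"
  by (rule glue_dist_le) (simp add: invariant_proj invariant_le_dist)

lemma compact_image: "compact (I ` D)"
  using compact_D lipschitz_on_continuous_on[OF lipschitz] by (rule compact_continuous_image[rotated])

text \<open>A cone supported in a small ball around x that misses D, I(D) and y. It vanishes on both
  glued sets, so it agrees at c and I c for a trivial reason.\<close>

lemma separating_outside_image:
  assumes "x \<in> S" "x \<notin> I ` D" "y \<noteq> x" shows "\<exists>f\<in>invariants. f x \<noteq> f y"
proof -
  let ?A = "insert y (D \<union> I ` D)"
  have "open (- ?A)"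
    using compact_imp_closed[OF compact_D] compact_imp_closed[OF compact_image]
    by (intro open_Compl closed_insert closed_Un)
  moreover have "x \<in> - ?A" using assms disjoint by auto
  ultimately obtain \<rho> where \<rho>: "\<rho> > 0" "ball x \<rho> \<subseteq> - ?A" unfolding open_contains_ball by blast
  have far: "\<rho> \<le> dist x z" if "z \<in> ?A" for z using \<rho>(2) that by (force simp: not_le[symmetric])
  let ?f = "\<lambda>z. max 0 (\<rho> - dist x z)"
  have "?f z = 0" if "z \<in> ?A" for z using far[OF that] by simp
  then have "?f \<in> invariants" "?f y = 0" using lipschitz_cone by (auto simp: invariants_def)
  moreover have "?f x \<noteq> 0" using \<rho>(1) by simp
  ultimately show ?thesis by metis
qed

text \<open>The Lipschitz bound on I controls two points of D; a pair with one point in D and one in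
  I(D) is controlled because these compact sets lie at a positive distance while I(D) is
  bounded.\<close>

lemma proj_lipschitz:
  obtains M where "M > 0"
    "\<And>c c'. c \<in> D \<union> I ` D \<Longrightarrow> c' \<in> D \<union> I ` D \<Longrightarrow> dist (proj c) (proj c') \<le> M * dist c c'"
proof -
  have disj: "D \<inter> I ` D = {}" using image disjoint unfolding disjoint_iff subset_iff by metis
  obtain \<sigma> where \<sigma>: "\<sigma> > 0" "\<And>c c'. c \<in> D \<Longrightarrow> c' \<in> I ` D \<Longrightarrow> \<sigma> \<le> dist c c'"
  proof (cases "D = {}")
    case False
    have "\<exists>p\<in>D \<times> I ` D. \<forall>q\<in>D \<times> I ` D. dist (fst p) (snd p) \<le> dist (fst q) (snd q)"
      using False compact_D compact_image
      by (intro continuous_attains_inf compact_Times continuous_intros) auto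
    then obtain p where p: "p \<in> D \<times> I ` D"
      "\<And>q. q \<in> D \<times> I ` D \<Longrightarrow> dist (fst p) (snd p) \<le> dist (fst q) (snd q)" by blast
    show thesis
    proof (rule that)
      show "0 < dist (fst p) (snd p)" using p(1) disj by auto
      show "dist (fst p) (snd p) \<le> dist c c'" if "c \<in> D" "c' \<in> I ` D" for c c'
        using p(2)[of "(c, c')"] that by simp
    qed
  qed (use that[of 1] in simp)
  obtain B where B: "\<And>c c'. c \<in> I ` D \<Longrightarrow> c' \<in> I ` D \<Longrightarrow> dist c c' \<le> B"
    using compact_imp_bounded[OF compact_image] bounded_two_points by metis
  \<comment> \<open>The three terms serve two points of I(D), which \<open>proj\<close> fixes, two
    points of D, and a mixed pair.\<close>
  define M where "M = max 1 (max L (B / \<sigma>))"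
  have M: "1 \<le> M" "L \<le> M" "B / \<sigma> \<le> M" by (auto simp: M_def)
  have mixed: "dist (I c) c' \<le> M * dist c c'" if "c \<in> D" "c' \<in> I ` D" for c c'
  proof -
    have "dist (I c) c' \<le> B" using B that by blast
    also have "\<dots> = B / \<sigma> * \<sigma>" using \<sigma>(1) by simp
    also have "\<dots> \<le> M * dist c c'" using M \<sigma> that by (intro mult_mono) auto
    finally show ?thesis .
  qed
  have "dist (proj c) (proj c') \<le> M * dist c c'"
    if c: "c \<in> D \<union> I ` D" and c': "c' \<in> D \<union> I ` D" for c c'
  proof (cases "c \<in> D")
    case True
    show ?thesis
    proof (cases "c' \<in> D")
      case True
      have "dist (I c) (I c') \<le> L * dist c c'" using lipschitz_onD[OF lipschitz] \<open>c \<in> D\<close> True .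
      also have "\<dots> \<le> M * dist c c'" using M by (intro mult_right_mono) auto
      finally show ?thesis using \<open>c \<in> D\<close> True by (simp add: proj_def)
    qed (use True c' mixed in \<open>simp add: proj_def\<close>)
  next
    case False
    show ?thesis
    proof (cases "c' \<in> D")
      case True
      then show ?thesis using False c mixed[of c' c] by (simp add: proj_def dist_commute)
    next
      case False
      then show ?thesis using \<open>c \<notin> D\<close> M(1) mult_right_mono[of 1 M "dist c c'"] by (simp add: proj_def)
    qed
  qed
  then show thesis using that[of M] M(1) by simp
qed

text \<open>The distance from x to \<open>proj c\<close> takes equal values at c and I c. Divided by
  M it is 1-Lipschitz on D and I(D) together, and its extension to the whole space keeps this
  invariance.\<close>

lemma separating_image:
  assumes "x \<in> I ` D" "y \<in> I ` D" "x \<noteq> y" shows "\<exists>f\<in>invariants. f x \<noteq> f y"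
proof -
  obtain M where M: "M > 0"
    "\<And>c c'. c \<in> D \<union> I ` D \<Longrightarrow> c' \<in> D \<union> I ` D \<Longrightarrow> dist (proj c) (proj c') \<le> M * dist c c'"
    using proj_lipschitz by blast
  let ?g = "\<lambda>c. dist x (proj c) / M"
  have "?g c - ?g c' \<le> dist c c'" if "c \<in> D \<union> I ` D" "c' \<in> D \<union> I ` D" for c c'
  proof -
    have "dist x (proj c) - dist x (proj c') \<le> M * dist c c'"
      using M(2)[OF that] dist_triangle[of x "proj c" "proj c'"] by (simp add: dist_commute)
    then show ?thesis using M(1) by (simp add: field_simps)
  qed
  moreover have "0 \<le> ?g c" for c using M(1) by simp
  moreover have "D \<union> I ` D \<noteq> {}" using assms by blast
  ultimately obtain h where h: "1-lipschitz_on UNIV h" "\<And>c. c \<in> D \<union> I ` D \<Longrightarrow> h c = ?g c"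
    using lipschitz_extension[of "D \<union> I ` D" ?g] by metis
  have proj_image: "proj z = z" if "z \<in> I ` D" for z
    using that disjoint image by (auto simp: proj_def)
  have "h (I c) = h c" if "c \<in> D" for c
    using that h(2)[of c] h(2)[of "I c"] proj_image[of "I c"] by (simp add: proj_def[of c])
  then have "h \<in> invariants" using h(1) by (simp add: invariants_def)
  moreover have "h x = 0" "h y = dist x y / M" using h(2) assms proj_image by auto
  ultimately show ?thesis using assms(3) M(1) by (intro bexI[of _ h]) auto
qed

lemma separating:
  assumes "x \<in> S" "y \<in> S" "x \<noteq> y" shows "\<exists>f\<in>invariants. f x \<noteq> f y"
  using assms separating_outside_image[of x y] separating_outside_image[of y x] separating_image[of x y]
  by metis

lemma Metric_space_glue: "Metric_space S glue_dist"
proof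
  fix x y z
  obtain f where f: "f \<in> invariants" using invariants_nonempty by blast
  show "0 \<le> glue_dist x y" using le_glue_dist[OF f, of x y] by linarith
  show "glue_dist x y = glue_dist y x" by (simp add: glue_dist_def abs_minus_commute)
  show "glue_dist x y = 0 \<longleftrightarrow> x = y" if "x \<in> S" "y \<in> S"
  proof
    assume "glue_dist x y = 0"
    then have "f x = f y" if "f \<in> invariants" for f using le_glue_dist[OF that, of x y] by simp
    then show "x = y" using separating that by blast
  next
    assume "x = y"
    then show "glue_dist x y = 0" using invariants_nonempty by (simp add: glue_dist_def)
  qed
  show "glue_dist x z \<le> glue_dist x y + glue_dist y z"
  proof (rule glue_dist_le)
    fix f assume "f \<in> invariants"
    then show "\<bar>f x - f z\<bar> \<le> glue_dist x y + glue_dist y z"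
      using le_glue_dist[of f x y] le_glue_dist[of f y z] by linarith
  qed
qed

definition Y :: "'a metric" where "Y = metric (S, glue_dist)"

lemma mspace_Y [simp]: "mspace Y = S"
  unfolding Y_def using Metric_space.mspace_metric[OF Metric_space_glue] .

lemma mdist_Y_proj_le: "mdist Y (proj x) (proj y) \<le> dist x y"
  unfolding Y_def Metric_space.mdist_metric[OF Metric_space_glue] by (rule glue_dist_proj_le)

lemma mdist_Y_le: assumes "x \<in> S" "y \<in> S" shows "mdist Y x y \<le> dist x y"
  using mdist_Y_proj_le[of x y] assms disjoint by (auto simp: proj_def split: if_splits)

end


section \<open>Separation numbers and growth rates\<close>

lemma log_enat_mono: "m \<le> n \<Longrightarrow> log_enat m \<le> log_enat n"
  by (cases m; cases n) (auto simp: log_enat_def)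

lemma growth_rate_mono:
  assumes "\<And>T. 0 \<le> T \<Longrightarrow> s T \<le> s' T" shows "growth_rate s \<le> growth_rate s'"
  unfolding growth_rate_def
proof (rule Limsup_mono, rule eventually_mono[OF eventually_gt_at_top[of 0]])
  fix T :: real assume "0 < T"
  then show "ereal (1 / T) * log_enat (s T) \<le> ereal (1 / T) * log_enat (s' T)"
    using assms by (intro ereal_mult_left_mono log_enat_mono) auto
qed

lemma log_enat_times:
  assumes "1 \<le> n" shows "log_enat (enat N * n) \<le> ereal (ln (real (max 1 N))) + log_enat n"
proof (cases n)
  case (enat k)
  then have "k \<ge> 1" using assms by (simp add: one_enat_def)
  show ?thesis
  proof (cases "N = 0")
    case False
    then have "ln (real (N * k)) = ln (real N) + ln (real k)" using \<open>k \<ge> 1\<close> by (simp add: ln_mult)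
    then show ?thesis using enat False \<open>k \<ge> 1\<close> by (simp add: log_enat_def max_def)
  qed (simp add: log_enat_def enat)
next
  case infinity
  then show ?thesis by (simp add: log_enat_def)
qed

text \<open>The factor N adds at most ln (max 1 N) / T to the rate, which vanishes as T
  grows.\<close>

lemma growth_rate_le_times:
  assumes "\<And>T. 0 \<le> T \<Longrightarrow> s T \<le> enat N * s' T" "\<And>T. 0 \<le> T \<Longrightarrow> 1 \<le> s' T"
  shows "growth_rate s \<le> growth_rate s'"
\<comment> \<open>Comparing with real upper bounds C of the right-hand side disposes of an infinite
  growth rate.\<close>
proof (rule ereal_le_real)
  fix C assume "growth_rate s' \<le> ereal C"
  define c where "c = ln (real (max 1 N))"
  have "growth_rate s \<le> ereal (C + e)" if "0 < e" for e
  proof -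
    have "growth_rate s' < ereal (C + e / 2)"
      using \<open>growth_rate s' \<le> ereal C\<close> that le_less_trans[of _ "ereal C" "ereal (C + e / 2)"] by simp
    then have "\<forall>\<^sub>F T in at_top. ereal (1 / T) * log_enat (s' T) < ereal (C + e / 2)"
      unfolding growth_rate_def by (rule Limsup_lessD)
    moreover have "((\<lambda>T::real. 1 / T * c) \<longlongrightarrow> 0) at_top"
      by (intro tendsto_mult_left_zero tendsto_divide_0[OF tendsto_const] filterlim_at_top_imp_at_infinity
          filterlim_ident)
    then have "\<forall>\<^sub>F T::real in at_top. 1 / T * c < e / 2" using that by (intro order_tendstoD) auto
    ultimately have "\<forall>\<^sub>F T in at_top. ereal (1 / T) * log_enat (s T) \<le> ereal (C + e)"
      using eventually_gt_at_top[of 0]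
    proof eventually_elim
      case (elim T)
      have "log_enat (s T) \<le> ereal c + log_enat (s' T)"
        using log_enat_mono[OF assms(1)[of T]] log_enat_times[OF assms(2)[of T], of N] elim(3)
        unfolding c_def by (meson less_imp_le order.trans)
      then have "ereal (1 / T) * log_enat (s T) \<le> ereal (1 / T) * (ereal c + log_enat (s' T))"
        using elim(3) by (intro ereal_mult_left_mono) auto
      also have "\<dots> = ereal (1 / T * c) + ereal (1 / T) * log_enat (s' T)"
        using elim(3) by (cases "log_enat (s' T)") (auto simp: algebra_simps add_divide_distrib)
      also have "\<dots> \<le> ereal (e / 2) + ereal (C + e / 2)"
        using elim(1,2) by (intro add_mono) (auto simp: less_imp_le)
      finally show ?case by (simp add: add.commute)
    qed
    then show ?thesis unfolding growth_rate_def by (rule Limsup_bounded)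
  qed
  then show "growth_rate s \<le> ereal C"
    by (intro ereal_le_epsilon2[of "growth_rate s" "ereal C"]) simp
qed

text \<open>\<open>Lim\<close> is a definite description and means nothing until a limit is known to
  exist. Monotonicity provides one, and from here on both entropies are handled as suprema.\<close>

lemma Lim_at_right_antimono:
  fixes f :: "real \<Rightarrow> ereal"
  assumes "\<And>a b. 0 < a \<Longrightarrow> a \<le> b \<Longrightarrow> f b \<le> f a"
  shows "Lim (at_right 0) f = (SUP a\<in>{0<..}. f a)"
proof (rule tendsto_Lim)
  show "(f \<longlongrightarrow> (SUP a\<in>{0<..}. f a)) (at_right 0)"
  proof (rule increasing_tendsto)
    show "\<forall>\<^sub>F a in at_right 0. f a \<le> (SUP a\<in>{0<..}. f a)"
      by (rule eventually_at_rightI[of 0 1]) (auto intro: SUP_upper)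
  next
    fix x assume "x < (SUP a\<in>{0<..}. f a)"
    then obtain a where a: "0 < a" "x < f a" by (auto simp: less_SUP_iff)
    show "\<forall>\<^sub>F b in at_right 0. x < f b"
    proof (rule eventually_at_rightI[of 0 a])
      fix b assume "b \<in> {0<..<a}"
      then show "x < f b" using assms[of b a] a(2) by (auto intro: less_le_trans)
    qed (use a in simp)
  qed
qed simp

lemma ecard_le_partition:
  assumes "finite P" "E \<subseteq> \<Union>P" "\<And>A. A \<in> P \<Longrightarrow> ecard (E \<inter> A) \<le> s"
  shows "ecard E \<le> enat (card P) * s"
proof (cases s)
  case (enat m)
  then have A: "finite (E \<inter> A)" "card (E \<inter> A) \<le> m" if "A \<in> P" for A
    using assms(3)[OF that] by (auto simp: ecard_def split: if_splits)
  have E: "E = (\<Union>A\<in>P. E \<inter> A)" using assms(2) by auto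
  then have "finite E" using A(1) assms(1) by (metis finite_UN_I)
  have "card E \<le> (\<Sum>A\<in>P. card (E \<inter> A))" by (subst E) (rule card_UN_le[OF assms(1)])
  also have "\<dots> \<le> card P * m" using sum_bounded_above[of P "\<lambda>A. card (E \<inter> A)" m] A(2) by simp
  finally show ?thesis using \<open>finite E\<close> enat by (simp add: ecard_def)
next
  case infinity
  \<comment> \<open>In \<open>enat\<close>, 0 times \<infinity> is 0, so the case without pieces is
    separate; there \<open>E\<close> is empty.\<close>
  show ?thesis
  proof (cases "P = {}")
    case True
    then show ?thesis using assms(2) by (simp add: ecard_def flip: zero_enat_def)
  next
    case False
    then have "card P \<noteq> 0" using assms(1) by simp
    then show ?thesis using infinity by simp
  qed
qed

lemma ecard_image: "inj_on f A \<Longrightarrow> ecard (f ` A) = ecard A"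
  by (simp add: ecard_def finite_image_iff card_image)

lemma delta_dist_lower: "0 \<le> s \<Longrightarrow> s < \<delta> \<Longrightarrow> delta_dist m \<phi> \<delta> x y \<le> mdist m (\<phi> s x) (\<phi> s y)"
  unfolding delta_dist_def by (rule cINF_lower) (auto intro!: bdd_belowI[of _ 0])

lemma delta_dist_greatest:
  "0 < \<delta> \<Longrightarrow> (\<And>s. 0 \<le> s \<Longrightarrow> s < \<delta> \<Longrightarrow> a \<le> mdist m (\<phi> s x) (\<phi> s y)) \<Longrightarrow> a \<le> delta_dist m \<phi> \<delta> x y"
  unfolding delta_dist_def by (rule cINF_greatest) auto

lemma delta_dist_antimono:
  assumes "0 < \<delta>" "\<delta> \<le> \<delta>'" shows "delta_dist m \<phi> \<delta>' x y \<le> delta_dist m \<phi> \<delta> x y"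
  using assms by (intro delta_dist_greatest delta_dist_lower) auto

text \<open>The time \<open>T\<close> comes last so that \<open>growth_rate\<close> can take the
  partial application.\<close>

definition sep_number :: "'a metric \<Rightarrow> (real \<Rightarrow> 'a \<Rightarrow> 'a) \<Rightarrow> real \<Rightarrow> real \<Rightarrow> enat" where
  "sep_number m \<psi> \<epsilon> T = (SUP E\<in>Collect (separated_set m \<psi> T \<epsilon>). ecard E)"

definition delta_sep_number ::
  "'a metric \<Rightarrow> (real \<Rightarrow> 'a \<Rightarrow> 'a) \<Rightarrow> real \<Rightarrow> real \<Rightarrow> real \<Rightarrow> enat" where
  "delta_sep_number m \<phi> \<delta> \<epsilon> T = (SUP E\<in>Collect (delta_separated_set m \<phi> T \<epsilon> \<delta>). ecard E)"

lemma sep_number_upper: "separated_set m \<psi> T \<epsilon> E \<Longrightarrow> ecard E \<le> sep_number m \<psi> \<epsilon> T"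
  unfolding sep_number_def by (intro SUP_upper) simp

lemma delta_sep_number_least:
  "(\<And>E. delta_separated_set m \<phi> T \<epsilon> \<delta> E \<Longrightarrow> ecard E \<le> n) \<Longrightarrow> delta_sep_number m \<phi> \<delta> \<epsilon> T \<le> n"
  unfolding delta_sep_number_def by (intro SUP_least) simp

lemma sep_number_le_delta_sep_number:
  assumes "\<And>E. separated_set m \<psi> T \<epsilon> E \<Longrightarrow> delta_separated_set m' \<phi> T \<epsilon>' \<delta> E"
  shows "sep_number m \<psi> \<epsilon> T \<le> delta_sep_number m' \<phi> \<delta> \<epsilon>' T"
  unfolding sep_number_def delta_sep_number_def
  by (rule SUP_subset_mono) (use assms in auto)

lemma sep_number_ge_1:
  assumes "x \<in> mspace m" shows "1 \<le> sep_number m \<psi> \<epsilon> T"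
  using sep_number_upper[of m \<psi> T \<epsilon> "{x}"] assms
  by (simp add: separated_set_def ecard_def one_enat_def)

lemma top_entropy_eq: "top_entropy m \<psi> = (SUP \<epsilon>\<in>{0<..}. growth_rate (sep_number m \<psi> \<epsilon>))"
proof -
  have "growth_rate (sep_number m \<psi> b) \<le> growth_rate (sep_number m \<psi> a)" if "0 < a" "a \<le> b" for a b
  proof (intro growth_rate_mono)
    fix T :: real
    have "separated_set m \<psi> T a E" if "separated_set m \<psi> T b E" for E
      using that \<open>a \<le> b\<close> unfolding separated_set_def by (meson order_trans)
    then show "sep_number m \<psi> b T \<le> sep_number m \<psi> a T"
      unfolding sep_number_def by (intro SUP_subset_mono) auto
  qed
  from Lim_at_right_antimono[OF this] show ?thesis
    unfolding top_entropy_def sep_number_def by simp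
qed

lemma delta_sep_number_antimono:
  assumes "\<epsilon> \<le> \<epsilon>'" "0 < \<delta>" "\<delta> \<le> \<delta>'"
  shows "delta_sep_number m \<phi> \<delta>' \<epsilon>' T \<le> delta_sep_number m \<phi> \<delta> \<epsilon> T"
proof -
  have "delta_separated_set m \<phi> T \<epsilon> \<delta> E" if "delta_separated_set m \<phi> T \<epsilon>' \<delta>' E" for E
    using that delta_dist_antimono[OF assms(2,3), of m \<phi>] assms(1)
    unfolding delta_separated_set_def by (meson order_trans)
  then show ?thesis unfolding delta_sep_number_def by (intro SUP_subset_mono) auto
qed

lemma hat_entropy_eq:
  "hat_entropy m \<phi> = (SUP \<delta>\<in>{0<..}. SUP \<epsilon>\<in>{0<..}. growth_rate (delta_sep_number m \<phi> \<delta> \<epsilon>))"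
proof -
  have "Lim (at_right 0) (\<lambda>\<epsilon>. growth_rate (delta_sep_number m \<phi> \<delta> \<epsilon>)) =
      (SUP \<epsilon>\<in>{0<..}. growth_rate (delta_sep_number m \<phi> \<delta> \<epsilon>))" if "0 < \<delta>" for \<delta>
    using that by (intro Lim_at_right_antimono growth_rate_mono delta_sep_number_antimono) auto
  moreover have "Lim (at_right 0) (\<lambda>\<delta>. Lim (at_right 0) (\<lambda>\<epsilon>. growth_rate (delta_sep_number m \<phi> \<delta> \<epsilon>))) =
     (SUP \<delta>\<in>{0<..}. Lim (at_right 0) (\<lambda>\<epsilon>. growth_rate (delta_sep_number m \<phi> \<delta> \<epsilon>)))"
  proof (rule Lim_at_right_antimono)
    fix a b :: real assume ab: "0 < a" "a \<le> b"
    show "Lim (at_right 0) (\<lambda>\<epsilon>. growth_rate (delta_sep_number m \<phi> b \<epsilon>))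
        \<le> Lim (at_right 0) (\<lambda>\<epsilon>. growth_rate (delta_sep_number m \<phi> a \<epsilon>))"
      using ab calculation[of a] calculation[of b]
      by (auto intro!: SUP_mono' growth_rate_mono delta_sep_number_antimono)
  qed
  ultimately show ?thesis
    unfolding hat_entropy_def delta_sep_number_def[symmetric] by simp
qed


section \<open>The impulsive semiflow in the glued metric\<close>

lemma LIMSEQ_by_subsequences:
  fixes a :: "nat \<Rightarrow> 'a::topological_space"
  assumes "\<And>r. strict_mono (r :: nat \<Rightarrow> nat) \<Longrightarrow>
    \<exists>q. strict_mono (q :: nat \<Rightarrow> nat) \<and> (\<lambda>n. a (r (q n))) \<longlonglongrightarrow> l"
  shows "a \<longlonglongrightarrow> l"
proof (rule topological_tendstoI, rule ccontr)
  fix A assume A: "open A" "l \<in> A" "\<not> (\<forall>\<^sub>F n in sequentially. a n \<in> A)"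
  obtain r where r: "strict_mono (r :: nat \<Rightarrow> nat)" "\<And>n. a (r n) \<notin> A"
    using not_eventually_sequentiallyD[OF A(3)] by blast
  obtain q where "(\<lambda>n. a (r (q n))) \<longlonglongrightarrow> l" using assms[OF r(1)] by blast
  then have "\<forall>\<^sub>F n in sequentially. a (r (q n)) \<in> A" using A(1,2) by (rule topological_tendstoD)
  then show False using r(2) by simp
qed

lemma LIMSEQ_if_less_inverse_Suc:
  fixes a :: "nat \<Rightarrow> real"
  assumes "\<And>n. \<bar>a n - l\<bar> < 1 / real (Suc n)" shows "a \<longlonglongrightarrow> l"
proof -
  have "(\<lambda>n. 1 / real (Suc n)) \<longlonglongrightarrow> 0" using LIMSEQ_Suc[OF lim_1_over_n] .
  then have "(\<lambda>n. a n - l) \<longlonglongrightarrow> 0"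
    by (rule Lim_null_comparison[rotated]) (use assms in \<open>auto intro!: always_eventually less_imp_le\<close>)
  then show ?thesis by (simp add: LIM_zero_iff)
qed

text \<open>The product topology is that of the product metric, so a failure of joint continuity at
  a point produces offending points within distance 1/(n+1) of it.\<close>

lemma continuous_semiflow_sequentialI:
  assumes semiflow: "semiflow_on (mspace m) \<psi>"
    and lim: "\<And>t t0 x x0. t \<longlonglongrightarrow> t0 \<Longrightarrow> (\<And>n::nat. 0 \<le> t n) \<Longrightarrow> (\<And>n. x n \<in> mspace m) \<Longrightarrow>
      x0 \<in> mspace m \<Longrightarrow> (\<lambda>n. mdist m (x n) x0) \<longlonglongrightarrow> 0 \<Longrightarrow>
      (\<lambda>n. mdist m (\<psi> (t n) (x n)) (\<psi> t0 x0)) \<longlonglongrightarrow> 0"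
  shows "continuous_semiflow (mtopology_of m) \<psi>"
proof -
  define R where "R = submetric euclidean_metric {0::real..}"
  interpret P: Metric_space12 "mspace R" "mdist R" "mspace m" "mdist m"
    by (rule Metric_space12_mspace_mdist)
  have R: "mspace R = {0..}" "mdist R = dist" by (auto simp: R_def)
  have "continuous_map P.Prod_metric.mtopology P.M2.mtopology (\<lambda>(t, x). \<psi> t x)"
    unfolding P.Prod_metric.metric_continuous_map[OF Metric_space_mspace_mdist]
  proof (intro conjI ballI allI impI)
    show "(\<lambda>(t, x). \<psi> t x) ` (mspace R \<times> mspace m) \<subseteq> mspace m"
      using semiflow by (auto simp: R semiflow_on_def)
  next
    fix a and \<epsilon> :: real assume a: "a \<in> mspace R \<times> mspace m" and "0 < \<epsilon>"
    obtain t0 x0 where a_eq: "a = (t0, x0)" by (cases a)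
    let ?d = "prod_dist (mdist R) (mdist m)"
    show "\<exists>\<delta>>0. \<forall>y. y \<in> mspace R \<times> mspace m \<and> ?d a y < \<delta> \<longrightarrow>
      mdist m (case a of (t, x) \<Rightarrow> \<psi> t x) (case y of (t, x) \<Rightarrow> \<psi> t x) < \<epsilon>"
    proof (rule ccontr)
      assume contra: "\<not> ?thesis"
      have "\<exists>t x. 0 \<le> t \<and> x \<in> mspace m \<and> ?d (t0, x0) (t, x) < 1 / real (Suc n) \<and>
          \<epsilon> \<le> mdist m (\<psi> t0 x0) (\<psi> t x)" for n
      proof -
        have "0 < 1 / real (Suc n)" by simp
        then obtain y where "y \<in> mspace R \<times> mspace m" "?d a y < 1 / real (Suc n)"
          "\<not> mdist m (case a of (t, x) \<Rightarrow> \<psi> t x) (case y of (t, x) \<Rightarrow> \<psi> t x) < \<epsilon>"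
          using contra by blast
        then show ?thesis by (cases y) (auto simp: a_eq R not_less)
      qed
      then obtain t x where tx: "\<And>n. 0 \<le> t n" "\<And>n. x n \<in> mspace m"
        "\<And>n. ?d (t0, x0) (t n, x n) < 1 / real (Suc n)"
        "\<And>n. \<epsilon> \<le> mdist m (\<psi> t0 x0) (\<psi> (t n) (x n))" by metis
      have "\<bar>t n - t0\<bar> < 1 / real (Suc n)" for n
        using P.component_le_prod_metric(1)[of t0 "t n" x0 "x n"] tx(3)[of n]
        by (simp add: R(2) dist_real_def abs_minus_commute)
      then have "t \<longlonglongrightarrow> t0" by (rule LIMSEQ_if_less_inverse_Suc)
      moreover have "\<bar>mdist m (x n) x0 - 0\<bar> < 1 / real (Suc n)" for n
        using P.component_le_prod_metric(2)[of x0 "x n" t0 "t n"] tx(3)[of n]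
        by (simp add: mdist_commute)
      then have "(\<lambda>n. mdist m (x n) x0) \<longlonglongrightarrow> 0" by (rule LIMSEQ_if_less_inverse_Suc)
      ultimately have "(\<lambda>n. mdist m (\<psi> (t n) (x n)) (\<psi> t0 x0)) \<longlonglongrightarrow> 0"
        using tx(1,2) a a_eq by (intro lim) auto
      then have "\<forall>\<^sub>F n in sequentially. mdist m (\<psi> (t n) (x n)) (\<psi> t0 x0) < \<epsilon>"
        using \<open>0 < \<epsilon>\<close> by (rule order_tendstoD)
      then show False using tx(4) by (auto simp: mdist_commute not_less[symmetric])
    qed
  qed
  moreover have "P.M1.mtopology = top_of_set {0..}"
    using mtopology_of_submetric[of "euclidean_metric" "{0::real..}"]
    by (simp add: mtopology_of_def flip: R_def)
  ultimately show ?thesis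
    using semiflow by (simp add: continuous_semiflow_def P.mtopology_prod_metric mtopology_of_def)
qed

context impulsive_regular
begin

sublocale glue: glueing S D I L
  using compact_D lipschitz_impulse impulse_mem_S by unfold_locales (auto simp: mem_S)

abbreviation Y :: "'a metric" where "Y \<equiv> glue.Y"

abbreviation dY :: "'a \<Rightarrow> 'a \<Rightarrow> real" where "dY \<equiv> mdist glue.Y"

abbreviation proj :: "'a \<Rightarrow> 'a" where "proj \<equiv> glue.proj"

lemma proj_simps [simp]: "z \<in> D \<Longrightarrow> proj z = I z" "z \<in> S \<Longrightarrow> proj z = z"
  by (auto simp: glue.proj_def mem_S)

lemma proj_mem_S: "z \<in> S \<union> D \<Longrightarrow> proj z \<in> S"
  using impulse_mem_S by auto

lemma limit_mem: "(\<And>n. x n \<in> S) \<Longrightarrow> x \<longlonglongrightarrow> z \<Longrightarrow> z \<in> S \<union> D"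
  using not_mem_U_limit[of x z] by (auto simp: mem_S)

text \<open>Translates limits in d into limits in the glued metric. A sequence in \<open>S\<close>
  may leave \<open>S\<close> in the limit, but only to some z in D, and then I z takes over.\<close>

lemma dY_tendsto_proj:
  assumes "\<And>n. x n \<in> S" "x \<longlonglongrightarrow> z" shows "(\<lambda>n. dY (x n) (proj z)) \<longlonglongrightarrow> 0"
proof (rule Lim_null_comparison)
  show "(\<lambda>n. dist (x n) z) \<longlonglongrightarrow> 0" using assms(2) by (rule tendsto_dist_iff[THEN iffD1])
  have "norm (dY (x n) (proj z)) \<le> dist (x n) z" for n
    using glue.mdist_Y_proj_le[of "x n" z] assms(1)[of n] by simp
  then show "\<forall>\<^sub>F n in sequentially. norm (dY (x n) (proj z)) \<le> dist (x n) z" by simp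
qed

lemma dY_triangle: "x \<in> S \<Longrightarrow> y \<in> S \<Longrightarrow> z \<in> S \<Longrightarrow> dY x z \<le> dY x y + dY y z"
  using mdist_triangle[of x Y y z] by simp

lemma dY_limit_unique:
  assumes "\<And>n. x n \<in> S" "a \<in> S" "b \<in> S"
    "(\<lambda>n. dY (x n) a) \<longlonglongrightarrow> 0" "(\<lambda>n. dY (x n) b) \<longlonglongrightarrow> 0"
  shows "a = b"
proof -
  have "dY a b \<le> dY (x n) a + dY (x n) b" for n
    using dY_triangle[of a "x n" b] assms(1-3) by (simp add: mdist_commute)
  moreover have "(\<lambda>n. dY (x n) a + dY (x n) b) \<longlonglongrightarrow> 0" using tendsto_add[OF assms(4,5)] by simp
  ultimately have "dY a b \<le> 0" by (intro LIMSEQ_le_const) auto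
  then show ?thesis using mdist_nonneg[of Y a b] mdist_zero[of a Y b] assms(2,3) by simp
qed

section \<open>Convergence of impulsive orbits in d and in the glued metric\<close>

lemma convergent_subsequence:
  obtains z r where "strict_mono (r :: nat \<Rightarrow> nat)" "(\<lambda>n. (x :: nat \<Rightarrow> 'a) (r n)) \<longlonglongrightarrow> z"
  using compact_imp_seq_compact[OF compact_UNIV] unfolding seq_compact_def o_def
  by (metis UNIV_I)

lemma impulsive_tendsto_before_hit:
  assumes x: "x \<longlonglongrightarrow> z" and "z \<notin> D" and t: "t \<longlonglongrightarrow> t0" "\<forall>\<^sub>F n in sequentially. 0 \<le> t n"
    and "ereal t0 < \<tau> z"
  shows "(\<lambda>n. F (t n) (x n)) \<longlonglongrightarrow> F t0 z"
proof -
  have "0 \<le> t0" using t by (rule tendsto_lowerbound) simp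
  have "\<forall>\<^sub>F n in sequentially. F (t n) (x n) = \<phi> (t n) (x n)"
    using eventually_before_hit[OF x \<open>z \<notin> D\<close> t(1) assms(5)] t(2)
    by eventually_elim (simp add: impulsive_before_hit)
  moreover have "(\<lambda>n. \<phi> (t n) (x n)) \<longlonglongrightarrow> \<phi> t0 z" using t(1) x \<open>0 \<le> t0\<close> t(2) by (rule flow_tendsto)
  ultimately show ?thesis
    using impulsive_before_hit[OF \<open>0 \<le> t0\<close> assms(5)] by (simp add: tendsto_cong)
qed

text \<open>Fixed once for all, so that the statements about short times need no existential
  quantifier.\<close>

definition hit_gap :: real where
  "hit_gap = (SOME \<beta>. 0 < \<beta> \<and> (\<forall>z\<in>D. ereal \<beta> < \<tau> (I z)))"

lemma hit_gap: "0 < hit_gap" "z \<in> D \<Longrightarrow> ereal hit_gap < \<tau> (I z)"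
  using someI_ex[of "\<lambda>\<beta>. 0 < \<beta> \<and> (\<forall>z\<in>D. ereal \<beta> < \<tau> (I z))"] ex_hit_gap
  unfolding hit_gap_def by blast+

text \<open>Unlike for \<open>\<tau>\<close>, time \<open>0\<close> counts as a visit of \<open>D\<close>.\<close>

definition arrives :: "'a \<Rightarrow> real \<Rightarrow> bool" where
  "arrives z r \<longleftrightarrow> 0 \<le> r \<and> \<phi> r z \<in> D \<and> (\<forall>u. 0 \<le> u \<longrightarrow> u < r \<longrightarrow> \<phi> u z \<notin> D)"

text \<open>A limit point z in D is represented by I z, as if the impulse had happened at time 0.
  Counting this as an arrival with r = 0 unifies it with genuine later impulses.\<close>

lemma arrival_cases [consumes 2]:
  assumes "z \<in> S \<union> D" "0 \<le> t"
  obtains (before) "z \<in> S" "ereal t < \<tau> z"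
  | (after) r where "arrives z r" "r \<le> t" "F t (proj z) = F (t - r) (I (\<phi> r z))"
proof (cases "z \<in> D")
  case True
  then show thesis using after[of 0] assms(2) by (simp add: arrives_def)
next
  case False
  then have "z \<in> S" using assms by simp
  show thesis
  proof (cases "ereal t < \<tau> z")
    case F: False
    then obtain r where r: "0 < r" "\<tau> z = ereal r" by (cases z rule: first_hit_cases) auto
    have "\<phi> u z \<notin> D" if "0 \<le> u" "u < r" for u
      using less_first_hit[of u z] that r(2) False by (cases "u = 0") auto
    then have "arrives z r" using r flow_first_hit[OF r(2)] by (simp add: arrives_def)
    then show thesis using after[of r] F r impulsive_after_hit[OF r(2)] \<open>z \<in> S\<close> by simp
  qed (use before \<open>z \<in> S\<close> in blast)
qed

text \<open>Once all orbits have jumped, convergence holds even in d: hitting times and restart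
  points converge, and the gap rules out a second impulse up to the limit time.\<close>

lemma impulsive_tendsto_after_hit:
  assumes x: "\<And>n. x n \<in> S" "x \<longlonglongrightarrow> z" and r: "arrives z r"
    and t: "t \<longlonglongrightarrow> t0" "t0 < r + hit_gap" and after: "\<forall>\<^sub>F n in sequentially. \<tau> (x n) \<le> ereal (t n)"
  shows "(\<lambda>n. F (t n) (x n)) \<longlonglongrightarrow> F (t0 - r) (I (\<phi> r z))"
proof -
  define h where "h n = real_of_ereal (\<tau> (x n))" for n
  have r': "0 \<le> r" "\<phi> r z \<in> D" "\<And>u. 0 \<le> u \<Longrightarrow> u < r \<Longrightarrow> \<phi> u z \<notin> D"
    using r by (auto simp: arrives_def)
  have h: "h \<longlonglongrightarrow> r" "\<forall>\<^sub>F n in sequentially. \<tau> (x n) = ereal (h n)"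
    using first_hit_tendsto[OF x r'] by (simp_all add: h_def[abs_def])
  have h_nonneg: "0 \<le> h n" for n
    unfolding h_def by (intro real_of_ereal_pos less_imp_le first_hit_pos)
  have "\<forall>\<^sub>F n in sequentially. \<phi> (h n) (x n) \<in> D"
    using h(2) by eventually_elim (rule flow_first_hit)
  moreover have "(\<lambda>n. \<phi> (h n) (x n)) \<longlonglongrightarrow> \<phi> r z"
    using h(1) x(2) r'(1) h_nonneg by (intro flow_tendsto) auto
  ultimately have "(\<lambda>n. I (\<phi> (h n) (x n))) \<longlonglongrightarrow> I (\<phi> r z)"
    by (intro continuous_on_tendsto_compose[OF lipschitz_on_continuous_on[OF lipschitz_impulse]] r'(2))
  moreover have "I (\<phi> r z) \<notin> D" using impulse_mem_S[OF r'(2)] by (simp add: mem_S)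
  moreover have "(\<lambda>n. t n - h n) \<longlonglongrightarrow> t0 - r" using tendsto_diff[OF t(1) h(1)] .
  moreover have "\<forall>\<^sub>F n in sequentially. 0 \<le> t n - h n"
    using after h(2) by eventually_elim simp
  moreover have "ereal (t0 - r) < \<tau> (I (\<phi> r z))"
    using hit_gap(2)[OF r'(2)] t(2) less_trans[of "ereal (t0 - r)" "ereal hit_gap"] by simp
  ultimately have "(\<lambda>n. F (t n - h n) (I (\<phi> (h n) (x n)))) \<longlonglongrightarrow> F (t0 - r) (I (\<phi> r z))"
    by (rule impulsive_tendsto_before_hit)
  moreover have "\<forall>\<^sub>F n in sequentially. F (t n) (x n) = F (t n - h n) (I (\<phi> (h n) (x n)))"
    using after h(2) by eventually_elim (simp add: impulsive_after_hit)
  ultimately show ?thesis by (simp add: tendsto_cong)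
qed

text \<open>Away from the arrival time r the convergence already holds in d. At t0 = r the orbits
  that have jumped are compared at t n, while \<open>t'\<close> postpones the others to their
  impulse so that one limit statement covers the whole sequence; those not yet jumped are near
  \<phi> r z, which is glued to I (\<phi> r z).\<close>

lemma dY_impulsive_tendsto_short:
  assumes x: "\<And>n. x n \<in> S" "x \<longlonglongrightarrow> z" and t: "\<And>n. 0 \<le> t n" "t \<longlonglongrightarrow> t0" "t0 < hit_gap"
  shows "(\<lambda>n. dY (F (t n) (x n)) (F t0 (proj z))) \<longlonglongrightarrow> 0"
proof -
  have "0 \<le> t0" using t(1,2) by (intro LIMSEQ_le_const) auto
  have zK: "z \<in> S \<union> D" using limit_mem x .
  have F_S: "F (t n) (x n) \<in> S" for n using impulsive_mem_S t(1) x(1) .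
  have conv: ?thesis if "(\<lambda>n. F (t n) (x n)) \<longlonglongrightarrow> F t0 (proj z)"
    using dY_tendsto_proj[OF F_S that] impulsive_mem_S[OF \<open>0 \<le> t0\<close> proj_mem_S[OF zK]] by simp
  show ?thesis using zK \<open>0 \<le> t0\<close>
  proof (cases rule: arrival_cases)
    case before
    then have "(\<lambda>n. F (t n) (x n)) \<longlonglongrightarrow> F t0 z"
      using x t by (intro impulsive_tendsto_before_hit) (auto simp: mem_S)
    then show ?thesis using conv before(1) by simp
  next
    case (after r)
    have r: "0 \<le> r" "\<phi> r z \<in> D" "\<And>u. 0 \<le> u \<Longrightarrow> u < r \<Longrightarrow> \<phi> u z \<notin> D"
      using after(1) by (auto simp: arrives_def)
    define h where "h n = real_of_ereal (\<tau> (x n))" for n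
    have h: "h \<longlonglongrightarrow> r" "\<forall>\<^sub>F n in sequentially. \<tau> (x n) = ereal (h n)"
      using first_hit_tendsto[OF x r] by (simp_all add: h_def[abs_def])
    show ?thesis
    proof (cases "r < t0")
      case True
      then obtain c where c: "r < c" "c < t0" using dense by blast
      have "\<forall>\<^sub>F n in sequentially. \<tau> (x n) \<le> ereal (t n)"
        using order_tendstoD(2)[OF h(1) c(1)] order_tendstoD(1)[OF t(2) c(2)] h(2)
        by eventually_elim simp
      then have "(\<lambda>n. F (t n) (x n)) \<longlonglongrightarrow> F (t0 - r) (I (\<phi> r z))"
        using r(1) t(2,3) by (intro impulsive_tendsto_after_hit[OF x after(1)]) auto
      then show ?thesis using conv after(3) by simp
    next
      case False
      then have "t0 = r" using after(2) by simp
      then have lim: "F t0 (proj z) = I (\<phi> r z)" using after(3) by simp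
      text \<open>At the impulse time itself, orbits that have not jumped yet are close to \<open>D\<close> and all
        others are close to \<open>I (\<phi> r z)\<close>; both are close in \<open>Y\<close>.\<close>
      define t' where "t' n = max (t n) (h n)" for n
      have t': "t' \<longlonglongrightarrow> r"
        using tendsto_max[OF t(2) h(1)] \<open>t0 = r\<close> unfolding t'_def[abs_def] by simp
      have "\<forall>\<^sub>F n in sequentially. \<tau> (x n) \<le> ereal (t' n)"
        using h(2) by eventually_elim (simp add: t'_def)
      then have "(\<lambda>n. F (t' n) (x n)) \<longlonglongrightarrow> F (r - r) (I (\<phi> r z))"
        using hit_gap(1) by (intro impulsive_tendsto_after_hit[OF x after(1) t']) auto
      then have "(\<lambda>n. F (t' n) (x n)) \<longlonglongrightarrow> I (\<phi> r z)" by simp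
      then have A: "(\<lambda>n. dist (F (t' n) (x n)) (I (\<phi> r z))) \<longlonglongrightarrow> 0"
        by (rule tendsto_dist_iff[THEN iffD1])
      have "(\<lambda>n. \<phi> (t n) (x n)) \<longlonglongrightarrow> \<phi> r z"
        using x(2) t(1,2) \<open>t0 = r\<close> r(1) by (intro flow_tendsto) auto
      then have B: "(\<lambda>n. dist (\<phi> (t n) (x n)) (\<phi> r z)) \<longlonglongrightarrow> 0"
        by (rule tendsto_dist_iff[THEN iffD1])
      have ISz: "I (\<phi> r z) \<in> S" using impulse_mem_S[OF r(2)] .
      have "\<forall>\<^sub>F n in sequentially. norm (dY (F (t n) (x n)) (F t0 (proj z))) \<le>
          dist (F (t' n) (x n)) (I (\<phi> r z)) + dist (\<phi> (t n) (x n)) (\<phi> r z)"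
        using h(2)
      proof eventually_elim
        case (elim n)
        show ?case
        proof (cases "t n < h n")
          case True
          then have eq: "F (t n) (x n) = \<phi> (t n) (x n)"
            using elim t(1)[of n] by (intro impulsive_before_hit) auto
          then have "dY (F (t n) (x n)) (I (\<phi> r z)) \<le> dist (\<phi> (t n) (x n)) (\<phi> r z)"
            using glue.mdist_Y_proj_le[of "\<phi> (t n) (x n)" "\<phi> r z"] F_S[of n] r(2) by simp
          then show ?thesis unfolding lim by (simp add: add_increasing)
        next
          case False
          then have "t' n = t n" by (simp add: t'_def)
          then have "dY (F (t n) (x n)) (I (\<phi> r z)) \<le> dist (F (t' n) (x n)) (I (\<phi> r z))"
            using glue.mdist_Y_le[OF F_S ISz] by simp
          then show ?thesis unfolding lim by (simp add: add_increasing2)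
        qed
      qed
      then show ?thesis by (rule Lim_null_comparison) (use tendsto_add[OF A B] in simp)
    qed
  qed
qed

text \<open>Convergence in the glued metric does not give convergence in d, but compactness gives
  d-convergent subsequences. Their limits may differ; each is represented by x0, by uniqueness of
  limits in the glued metric.\<close>

lemma dY_impulsive_tendsto_short':
  assumes x: "\<And>n. x n \<in> S" "x0 \<in> S" "(\<lambda>n. dY (x n) x0) \<longlonglongrightarrow> 0"
    and t: "\<And>n. 0 \<le> t n" "t \<longlonglongrightarrow> t0" "t0 < hit_gap"
  shows "(\<lambda>n. dY (F (t n) (x n)) (F t0 x0)) \<longlonglongrightarrow> 0"
proof (rule LIMSEQ_by_subsequences)
  fix r :: "nat \<Rightarrow> nat" assume r: "strict_mono r"
  obtain z q where q: "strict_mono (q :: nat \<Rightarrow> nat)" "(\<lambda>n. x (r (q n))) \<longlonglongrightarrow> z"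
    using convergent_subsequence[of "\<lambda>n. x (r n)"] by metis
  have rq: "strict_mono (\<lambda>n. r (q n))" using strict_mono_compose[OF r q(1)] .
  have "proj z = x0"
  proof (rule dY_limit_unique)
    show "(\<lambda>n. dY (x (r (q n))) (proj z)) \<longlonglongrightarrow> 0" using dY_tendsto_proj[OF _ q(2)] x(1) by simp
    show "(\<lambda>n. dY (x (r (q n))) x0) \<longlonglongrightarrow> 0" using LIMSEQ_subseq_LIMSEQ[OF x(3) rq] by (simp add: o_def)
    show "proj z \<in> S" using proj_mem_S limit_mem[OF _ q(2)] x(1) by simp
  qed (use x in auto)
  moreover have "(\<lambda>n. dY (F (t (r (q n))) (x (r (q n)))) (F t0 (proj z))) \<longlonglongrightarrow> 0"
    using x(1) t(1,3) LIMSEQ_subseq_LIMSEQ[OF t(2) rq]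
    by (intro dY_impulsive_tendsto_short[OF _ q(2)]) (auto simp: o_def)
  ultimately show "\<exists>q. strict_mono q \<and> (\<lambda>n. dY (F (t (r (q n))) (x (r (q n)))) (F t0 x0)) \<longlonglongrightarrow> 0"
    using q(1) by auto
qed

text \<open>A long time is cut into k parts, each shorter than the gap in the limit, and the
  semigroup law applies the short-time statement to one part after another.\<close>

lemma dY_impulsive_tendsto:
  assumes x: "\<And>n. x n \<in> S" "x0 \<in> S" "(\<lambda>n. dY (x n) x0) \<longlonglongrightarrow> 0"
    and t: "\<And>n. 0 \<le> t n" "t \<longlonglongrightarrow> t0"
  shows "(\<lambda>n. dY (F (t n) (x n)) (F t0 x0)) \<longlonglongrightarrow> 0"
proof -
  obtain k :: nat where "t0 < real k * hit_gap"
    using ex_less_of_nat_mult[OF hit_gap(1)] by blast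
  then show ?thesis using t
  proof (induction k arbitrary: t t0)
    case 0
    then have "0 \<le> t0" by (intro LIMSEQ_le_const[OF "0.prems"(3)]) auto
    then show ?case using 0 by simp
  next
    case (Suc k)
    \<comment> \<open>Each t n is split in the same proportion. Subtracting a fixed duration instead
      could make some of the times negative.\<close>
    define c where "c = real k / real (Suc k)"
    define e where "e = 1 / real (Suc k)"
    have ce: "0 \<le> c" "0 < e" "c + e = 1" by (auto simp: c_def e_def add_divide_distrib[symmetric])
    have "0 \<le> t0" by (intro LIMSEQ_le_const[OF Suc.prems(3)]) (use Suc.prems in auto)
    have e_t0: "e * t0 < hit_gap" using Suc.prems(1) by (simp add: e_def field_simps)
    have IH: "(\<lambda>n. dY (F (c * t n) (x n)) (F (c * t0) x0)) \<longlonglongrightarrow> 0"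
    proof (cases "k = 0")
      case True
      then show ?thesis using x(3) by (simp add: c_def)
    next
      case False
      show ?thesis
      proof (rule Suc.IH)
        have "c * t0 = real k * (e * t0)" by (simp add: c_def e_def)
        also have "\<dots> < real k * hit_gap" using False e_t0 by (intro mult_strict_left_mono) auto
        finally show "c * t0 < real k * hit_gap" .
        show "0 \<le> c * t n" for n using ce Suc.prems(2) by simp
        show "(\<lambda>n. c * t n) \<longlonglongrightarrow> c * t0" using Suc.prems(3) by (intro tendsto_mult tendsto_const)
      qed
    qed
    have split: "F s y = F (e * s) (F (c * s) y)" if "0 \<le> s" for s y
    proof -
      have "e * s + c * s = s" using ce(3) by (metis add.commute distrib_right mult_1)
      then show ?thesis using impulsive_add[of "c * s" "e * s" y] that ce by simp
    qed
    have "(\<lambda>n. dY (F (e * t n) (F (c * t n) (x n))) (F (e * t0) (F (c * t0) x0))) \<longlonglongrightarrow> 0"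
    proof (rule dY_impulsive_tendsto_short'[OF _ _ IH _ _ e_t0])
      show "(\<lambda>n. e * t n) \<longlonglongrightarrow> e * t0" using Suc.prems(3) by (intro tendsto_mult tendsto_const)
    qed (use ce Suc.prems(2) x \<open>0 \<le> t0\<close> in \<open>auto intro!: impulsive_mem_S\<close>)
    then show ?case using split[OF Suc.prems(2)] split[OF \<open>0 \<le> t0\<close>] by simp
  qed
qed

lemma continuous_semiflow_Y: "continuous_semiflow (mtopology_of Y) F"
proof (rule continuous_semiflow_sequentialI)
  show "semiflow_on (mspace Y) F"
    using impulsive_mem_S impulsive_add by (simp add: semiflow_on_def)
qed (use dY_impulsive_tendsto in simp)

text \<open>Sequential compactness is inherited from X: the d-limit z of a subsequence lies in
  \<open>S\<close> or D, and \<open>proj z\<close> is the limit in the glued metric.\<close>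

lemma compact_space_Y: "compact_space (mtopology_of Y)"
proof -
  interpret M: Metric_space "mspace Y" "mdist Y" by (rule Metric_space_mspace_mdist)
  have "compact_space M.mtopology"
    unfolding M.compact_space_sequentially M.limitin_metric_dist_null
  proof (intro allI impI)
    fix x :: "nat \<Rightarrow> 'a" assume "range x \<subseteq> mspace Y"
    then have x: "x n \<in> S" for n by auto
    obtain z r where r: "strict_mono (r :: nat \<Rightarrow> nat)" "(\<lambda>n. x (r n)) \<longlonglongrightarrow> z"
      using convergent_subsequence[of x] by metis
    have "(\<lambda>n. dY (x (r n)) (proj z)) \<longlonglongrightarrow> 0" using dY_tendsto_proj[OF _ r(2)] x by simp
    moreover have "proj z \<in> S" using proj_mem_S limit_mem[OF _ r(2)] x by simp
    ultimately show "\<exists>l r. l \<in> mspace Y \<and> strict_mono r \<and>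
        l \<in> mspace Y \<and> (\<forall>\<^sub>F n in sequentially. (x \<circ> r) n \<in> mspace Y) \<and> (\<lambda>n. dY ((x \<circ> r) n) l) \<longlonglongrightarrow> 0"
      using r(1) x by (intro exI[of _ "proj z"] exI[of _ r]) (simp add: o_def)
  qed
  then show ?thesis by (simp add: mtopology_of_def)
qed

section \<open>Uniform estimates by compactness and the comparison of entropies\<close>

lemma dY_impulsive_tendsto_proj:
  assumes x: "\<And>n. x n \<in> S" "x \<longlonglongrightarrow> z" and t: "\<And>n. 0 \<le> t n" "t \<longlonglongrightarrow> t0"
  shows "(\<lambda>n. dY (F (t n) (x n)) (F t0 (proj z))) \<longlonglongrightarrow> 0"
  using x t proj_mem_S[OF limit_mem[OF x]] dY_tendsto_proj[OF x] by (intro dY_impulsive_tendsto) auto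

lemma dY_tendsto_common_limit:
  assumes "\<And>n. x n \<in> S" "\<And>n. y n \<in> S" "a \<in> S"
    and "(\<lambda>n. dY (x n) a) \<longlonglongrightarrow> 0" "(\<lambda>n. dY (y n) a) \<longlonglongrightarrow> 0" "0 < \<epsilon>"
  shows "\<exists>n. dY (x n) (y n) < \<epsilon>"
proof -
  have "(\<lambda>n. dY (x n) a + dY (y n) a) \<longlonglongrightarrow> 0" using tendsto_add[OF assms(4,5)] by simp
  then have "\<forall>\<^sub>F n in sequentially. dY (x n) a + dY (y n) a < \<epsilon>" using assms(6) by (rule order_tendstoD)
  then obtain n where "dY (x n) a + dY (y n) a < \<epsilon>" by (auto simp: eventually_sequentially)
  then have "dY (x n) (y n) < \<epsilon>"
    using dY_triangle[of "x n" a "y n"] assms(1-3) by (simp add: mdist_commute)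
  then show ?thesis ..
qed

text \<open>False for d in place of the glued metric, in which the jumps are invisible: a point just
  before D would move far in an arbitrarily short time.\<close>

lemma impulsive_small_time:
  assumes "0 < \<epsilon>" shows "\<exists>\<delta>>0. \<forall>u\<in>S. \<forall>s\<in>{0..<\<delta>}. dY (F s u) u < \<epsilon>"
proof (rule ccontr)
  assume contra: "\<not> ?thesis"
  have "\<exists>u s. u \<in> S \<and> 0 \<le> s \<and> s < 1 / real (Suc n) \<and> \<epsilon> \<le> dY (F s u) u" for n
  proof -
    have "0 < 1 / real (Suc n)" by simp
    then obtain u s where "u \<in> S" "s \<in> {0..<1 / real (Suc n)}" "\<not> dY (F s u) u < \<epsilon>"
      using contra by blast
    then show ?thesis by (intro exI[of _ u] exI[of _ s]) auto
  qed
  then obtain u s where us: "\<And>n. u n \<in> S" "\<And>n. 0 \<le> s n" "\<And>n. s n < 1 / real (Suc n)"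
    "\<And>n. \<epsilon> \<le> dY (F (s n) (u n)) (u n)" by metis
  obtain z r where r: "strict_mono (r :: nat \<Rightarrow> nat)" "(\<lambda>n. u (r n)) \<longlonglongrightarrow> z"
    using convergent_subsequence[of u] by metis
  have "s \<longlonglongrightarrow> 0" using us(2,3) by (intro LIMSEQ_if_less_inverse_Suc) simp
  then have "(\<lambda>n. s (r n)) \<longlonglongrightarrow> 0" using LIMSEQ_subseq_LIMSEQ[OF _ r(1)] by (auto simp: o_def)
  then have "(\<lambda>n. dY (F (s (r n)) (u (r n))) (F 0 (proj z))) \<longlonglongrightarrow> 0"
    using us(1,2) r(2) by (intro dY_impulsive_tendsto_proj) auto
  moreover have "(\<lambda>n. dY (u (r n)) (proj z)) \<longlonglongrightarrow> 0" using dY_tendsto_proj us(1) r(2) .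
  ultimately obtain n where "dY (F (s (r n)) (u (r n))) (u (r n)) < \<epsilon>"
    using dY_tendsto_common_limit[of "\<lambda>n. F (s (r n)) (u (r n))" "\<lambda>n. u (r n)" "proj z" \<epsilon>]
      us(1,2) impulsive_mem_S proj_mem_S limit_mem[OF _ r(2)] assms by auto
  then show False using us(4)[of "r n"] by simp
qed

text \<open>In a counterexample sequence both points converge in d to the same z and both orbits
  converge to that of \<open>proj z\<close>. Closeness of the starting points is in d, that of the
  orbits only in the glued metric.\<close>

lemma impulsive_equicontinuous_on_S:
  assumes "0 < \<epsilon>"
  shows "\<exists>\<rho>>0. \<forall>x\<in>S. \<forall>y\<in>S. dist x y < \<rho> \<longrightarrow> (\<forall>t\<in>{0..a}. dY (F t x) (F t y) < \<epsilon>)"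
proof (rule ccontr)
  assume contra: "\<not> ?thesis"
  have "\<exists>x y t. x \<in> S \<and> y \<in> S \<and> dist x y < 1 / real (Suc n) \<and> t \<in> {0..a} \<and> \<epsilon> \<le> dY (F t x) (F t y)" for n
  proof -
    have "0 < 1 / real (Suc n)" by simp
    then obtain x y t where "x \<in> S" "y \<in> S" "dist x y < 1 / real (Suc n)" "t \<in> {0..a}"
      "\<not> dY (F t x) (F t y) < \<epsilon>" using contra by blast
    then show ?thesis by (intro exI[of _ x] exI[of _ y] exI[of _ t]) auto
  qed
  then obtain x y t where xyt: "\<And>n. x n \<in> S" "\<And>n. y n \<in> S" "\<And>n. dist (x n) (y n) < 1 / real (Suc n)"
    "\<And>n. t n \<in> {0..a}" "\<And>n. \<epsilon> \<le> dY (F (t n) (x n)) (F (t n) (y n))" by metis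
  obtain z r where r: "strict_mono (r :: nat \<Rightarrow> nat)" "(\<lambda>n. x (r n)) \<longlonglongrightarrow> z"
    using convergent_subsequence[of x] by metis
  have "\<forall>n. t (r n) \<in> {0..a}" using xyt(4) by simp
  from seq_compactE[OF compact_imp_seq_compact[OF compact_Icc] this]
  obtain t0 q where "strict_mono (q :: nat \<Rightarrow> nat)" "((\<lambda>n. t (r n)) \<circ> q) \<longlonglongrightarrow> t0" by blast
  then have q: "strict_mono q" "(\<lambda>n. t (r (q n))) \<longlonglongrightarrow> t0" by (simp_all add: o_def)
  define p where "p n = r (q n)" for n
  have p: "strict_mono p" using strict_mono_compose[OF r(1) q(1)] by (simp add: p_def[abs_def])
  have xp: "(\<lambda>n. x (p n)) \<longlonglongrightarrow> z" using LIMSEQ_subseq_LIMSEQ[OF r(2) q(1)] by (simp add: o_def p_def)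
  have tp: "(\<lambda>n. t (p n)) \<longlonglongrightarrow> t0" using q(2) by (simp add: p_def)
  have "(\<lambda>n. dist (x n) (y n)) \<longlonglongrightarrow> 0" using xyt(3) by (intro LIMSEQ_if_less_inverse_Suc) simp
  then have "(\<lambda>n. dist (x (p n)) (y (p n))) \<longlonglongrightarrow> 0" using LIMSEQ_subseq_LIMSEQ[OF _ p] by (auto simp: o_def)
  then have xyp: "(\<lambda>n. dist (x (p n)) (y (p n)) + dist (x (p n)) z) \<longlonglongrightarrow> 0"
    using tendsto_add[OF _ tendsto_dist_iff[THEN iffD1, OF xp]] by fastforce
  have "norm (dist (y (p n)) z) \<le> dist (x (p n)) (y (p n)) + dist (x (p n)) z" for n
    using dist_triangle3[of "y (p n)" z "x (p n)"] by simp
  then have "(\<lambda>n. dist (y (p n)) z) \<longlonglongrightarrow> 0"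
    by (intro Lim_null_comparison[OF always_eventually xyp] allI)
  then have yp: "(\<lambda>n. y (p n)) \<longlonglongrightarrow> z" by (rule tendsto_dist_iff[THEN iffD2])
  have "0 \<le> t0" using xyt(4) by (intro LIMSEQ_le_const[OF tp]) auto
  have "(\<lambda>n. dY (F (t (p n)) (x (p n))) (F t0 (proj z))) \<longlonglongrightarrow> 0"
    using xyt(1,4) xp tp by (intro dY_impulsive_tendsto_proj) auto
  moreover have "(\<lambda>n. dY (F (t (p n)) (y (p n))) (F t0 (proj z))) \<longlonglongrightarrow> 0"
    using xyt(2,4) yp tp by (intro dY_impulsive_tendsto_proj) auto
  moreover have "F t0 (proj z) \<in> S"
    using impulsive_mem_S[OF \<open>0 \<le> t0\<close> proj_mem_S] limit_mem[OF _ xp] xyt(1) by simp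
  moreover have "F (t (p n)) (x (p n)) \<in> S" "F (t (p n)) (y (p n)) \<in> S" for n
    using xyt(1,2,4) by (auto intro!: impulsive_mem_S)
  ultimately obtain n where "dY (F (t (p n)) (x (p n))) (F (t (p n)) (y (p n))) < \<epsilon>"
    using dY_tendsto_common_limit[of "\<lambda>n. F (t (p n)) (x (p n))" "\<lambda>n. F (t (p n)) (y (p n))"
        "F t0 (proj z)" \<epsilon>] assms by blast
  then show False using xyt(5)[of "p n"] by simp
qed

text \<open>Outside \<open>S\<close> no impulse occurs up to time \<xi>, so uniform continuity of
  \<phi> on a compact set suffices, and the estimate is in d itself.\<close>

lemma impulsive_equicontinuous_on_tube:
  assumes "0 < \<epsilon>"
  shows "\<exists>\<rho>>0. \<forall>x\<in>-S. \<forall>y\<in>-S. dist x y < \<rho> \<longrightarrow> (\<forall>t\<in>{0..\<xi>}. dist (F t x) (F t y) < \<epsilon>)"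
proof -
  have "uniformly_continuous_on ({0..\<xi>} \<times> UNIV) (\<lambda>(t, x). \<phi> t x)"
    using compact_UNIV
    by (intro compact_uniformly_continuous continuous_on_subset[OF continuous_flow] compact_Times compact_Icc) auto
  then obtain \<rho> where \<rho>: "\<rho> > 0" "\<And>p q. p \<in> {0..\<xi>} \<times> UNIV \<Longrightarrow> q \<in> {0..\<xi>} \<times> UNIV \<Longrightarrow> dist q p < \<rho> \<Longrightarrow>
      dist (case q of (t, x) \<Rightarrow> \<phi> t x) (case p of (t, x) \<Rightarrow> \<phi> t x) < \<epsilon>"
    using assms unfolding uniformly_continuous_on_def by metis
  have "dist (F t x) (F t y) < \<epsilon>" if "x \<in> -S" "y \<in> -S" "dist x y < \<rho>" "t \<in> {0..\<xi>}" for x y t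
  proof -
    have "F t x = \<phi> t x" "F t y = \<phi> t y" using that by (auto intro!: impulsive_tube_eq simp: mem_S)
    then show ?thesis using \<rho>(2)[of "(t, y)" "(t, x)"] that(3,4) by (simp add: dist_Pair_Pair)
  qed
  then show ?thesis using \<rho>(1) by blast
qed

text \<open>Points that become close in the glued metric may have different limits a and b in d, for
  instance a in D and b = I a. The limits are glued, though, and at a small positive time s the
  orbits have made any impulse due at the start, so they are close in d.\<close>

lemma delta_dist_small:
  assumes "0 < \<epsilon>" "0 < \<delta>"
  shows "\<exists>\<epsilon>'>0. \<forall>u\<in>S. \<forall>v\<in>S. dY u v < \<epsilon>' \<longrightarrow> delta_dist euclidean_metric F \<delta> u v < \<epsilon>"
proof (rule ccontr)
  assume contra: "\<not> ?thesis"
  have "\<exists>u v. u \<in> S \<and> v \<in> S \<and> dY u v < 1 / real (Suc n) \<and> \<epsilon> \<le> delta_dist euclidean_metric F \<delta> u v" for n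
  proof -
    have "0 < 1 / real (Suc n)" by simp
    then show ?thesis using contra by (meson not_less)
  qed
  then obtain u v where uv: "\<And>n. u n \<in> S" "\<And>n. v n \<in> S" "\<And>n. dY (u n) (v n) < 1 / real (Suc n)"
    "\<And>n. \<epsilon> \<le> delta_dist euclidean_metric F \<delta> (u n) (v n)" by metis
  obtain a r where r: "strict_mono (r :: nat \<Rightarrow> nat)" "(\<lambda>n. u (r n)) \<longlonglongrightarrow> a"
    using convergent_subsequence[of u] by metis
  obtain b q where q: "strict_mono (q :: nat \<Rightarrow> nat)" "(\<lambda>n. v (r (q n))) \<longlonglongrightarrow> b"
    using convergent_subsequence[of "\<lambda>n. v (r n)"] by metis
  define p where "p n = r (q n)" for n
  have p: "strict_mono p" using strict_mono_compose[OF r(1) q(1)] by (simp add: p_def[abs_def])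
  have up: "(\<lambda>n. u (p n)) \<longlonglongrightarrow> a" using LIMSEQ_subseq_LIMSEQ[OF r(2) q(1)] by (simp add: o_def p_def)
  have vp: "(\<lambda>n. v (p n)) \<longlonglongrightarrow> b" using q(2) by (simp add: p_def)
  have aK: "a \<in> S \<union> D" and bK: "b \<in> S \<union> D" using limit_mem up vp uv(1,2) by metis+
  have u0: "(\<lambda>n. dY (u (p n)) (proj a)) \<longlonglongrightarrow> 0" and v0: "(\<lambda>n. dY (v (p n)) (proj b)) \<longlonglongrightarrow> 0"
    using dY_tendsto_proj up vp uv(1,2) by simp_all
  have "(\<lambda>n. dY (u n) (v n)) \<longlonglongrightarrow> 0" using uv(3) by (intro LIMSEQ_if_less_inverse_Suc) simp
  then have uv0: "(\<lambda>n. dY (u (p n)) (v (p n))) \<longlonglongrightarrow> 0" using LIMSEQ_subseq_LIMSEQ[OF _ p] by (auto simp: o_def)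
  have "(\<lambda>n. dY (v (p n)) (proj a)) \<longlonglongrightarrow> 0"
  proof (rule Lim_null_comparison)
    show "(\<lambda>n. dY (u (p n)) (v (p n)) + dY (u (p n)) (proj a)) \<longlonglongrightarrow> 0" using tendsto_add[OF uv0 u0] by simp
    show "\<forall>\<^sub>F n in sequentially. norm (dY (v (p n)) (proj a)) \<le> dY (u (p n)) (v (p n)) + dY (u (p n)) (proj a)"
      using dY_triangle[OF uv(2) uv(1) proj_mem_S[OF aK]] by (auto intro!: always_eventually simp: mdist_commute)
  qed
  then have ab: "proj a = proj b"
    using dY_limit_unique[of "\<lambda>n. v (p n)" "proj a" "proj b"] uv(2) proj_mem_S aK bK v0 by blast
  \<comment> \<open>Below \<delta> the time counts in the infimum; below the gap and the hitting
    time of the common representative, no further impulse interferes.\<close>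
  obtain s where s: "0 < s" "s < \<delta>" "s < hit_gap" "ereal s < \<tau> (proj a)"
  proof -
    obtain h where h: "0 < h" "ereal h < \<tau> (proj a)"
      using ereal_dense2[OF first_hit_pos[of "proj a"]] by (auto simp: zero_ereal_def)
    define s where "s = min h (min \<delta> hit_gap) / 2"
    have "0 < s" "s < \<delta>" "s < hit_gap" "s < h" using h(1) assms(2) hit_gap(1) by (auto simp: s_def min_def)
    moreover from \<open>s < h\<close> have "ereal s < \<tau> (proj a)" using h(2) by (meson less_trans less_ereal.simps(1))
    ultimately show thesis using that by blast
  qed
  \<comment> \<open>If c is in D, the orbits of x n eventually jump before time s; otherwise they
    eventually flow up to time s without an impulse.\<close>
  have lim: "(\<lambda>n. F s (x n)) \<longlonglongrightarrow> F s (proj c)"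
    if "\<And>n. x n \<in> S" "x \<longlonglongrightarrow> c" "c \<in> S \<union> D" "ereal s < \<tau> (proj c)" for x c
  proof (cases "c \<in> D")
    case True
    then have "arrives c 0" by (simp add: arrives_def)
    moreover have "\<forall>\<^sub>F n in sequentially. \<tau> (x n) \<le> ereal s"
      using eventually_after_hit[OF that(1,2), of 0 s] True s(1) by (auto elim: eventually_mono simp: less_imp_le)
    ultimately have "(\<lambda>n. F s (x n)) \<longlonglongrightarrow> F (s - 0) (I (\<phi> 0 c))"
      using s(3) that(1,2) by (intro impulsive_tendsto_after_hit) auto
    then show ?thesis using True by simp
  next
    case False
    then show ?thesis using that s(1) by (auto intro!: impulsive_tendsto_before_hit)
  qed
  have "(\<lambda>n. F s (u (p n))) \<longlonglongrightarrow> F s (proj a)" using lim[OF _ up aK s(4)] uv(1) by simp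
  moreover have "(\<lambda>n. F s (v (p n))) \<longlonglongrightarrow> F s (proj a)"
    using lim[OF _ vp bK] s(4) uv(2) unfolding ab by simp
  ultimately have "(\<lambda>n. dist (F s (u (p n))) (F s (v (p n)))) \<longlonglongrightarrow> 0"
    using tendsto_dist[of "\<lambda>n. F s (u (p n))" "F s (proj a)" _ "\<lambda>n. F s (v (p n))" "F s (proj a)"] by simp
  then have "\<forall>\<^sub>F n in sequentially. dist (F s (u (p n))) (F s (v (p n))) < \<epsilon>"
    using assms(1) by (rule order_tendstoD)
  then obtain n where "dist (F s (u (p n))) (F s (v (p n))) < \<epsilon>" by (auto simp: eventually_sequentially)
  moreover have "\<epsilon> \<le> dist (F s (u (p n))) (F s (v (p n)))"
    using uv(4)[of "p n"] delta_dist_lower[of s \<delta> euclidean_metric F "u (p n)" "v (p n)"] s by simp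
  ultimately show False by simp
qed

text \<open>During [0,\<delta>) every orbit moves by less than \<epsilon>/4 in the glued metric, so
  two points at distance \<epsilon> keep \<epsilon>/2 throughout, and d is at least as
  large.\<close>

lemma separated_imp_delta_separated:
  assumes "0 < \<epsilon>"
  shows "\<exists>\<delta>>0. \<forall>T E. separated_set Y F T \<epsilon> E \<longrightarrow> delta_separated_set euclidean_metric F T (\<epsilon> / 2) \<delta> E"
proof -
  obtain \<delta> where \<delta>: "\<delta> > 0" "\<And>u s. u \<in> S \<Longrightarrow> 0 \<le> s \<Longrightarrow> s < \<delta> \<Longrightarrow> dY (F s u) u < \<epsilon> / 4"
    using impulsive_small_time[of "\<epsilon> / 4"] assms by (metis atLeastLessThan_iff divide_pos_pos zero_less_numeral)
  have key: "\<epsilon> / 2 \<le> delta_dist euclidean_metric F \<delta> u v"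
    if "u \<in> S" "v \<in> S" "\<epsilon> \<le> dY u v" for u v
  proof (rule delta_dist_greatest[OF \<delta>(1)])
    fix s :: real assume s: "0 \<le> s" "s < \<delta>"
    have FS: "F s u \<in> S" "F s v \<in> S" using s that impulsive_mem_S by auto
    have "dY u v \<le> dY (F s u) u + dY (F s u) (F s v) + dY (F s v) v"
      using dY_triangle[of u "F s u" v] dY_triangle[of "F s u" "F s v" v] FS that
      by (simp add: mdist_commute)
    also have "\<dots> \<le> \<epsilon> / 2 + dist (F s u) (F s v)"
      using \<delta>(2)[of u s] \<delta>(2)[of v s] that s glue.mdist_Y_le[OF FS] by simp
    finally show "\<epsilon> / 2 \<le> mdist euclidean_metric (F s u) (F s v)" using that(3) by simp
  qed
  have "delta_separated_set euclidean_metric F T (\<epsilon> / 2) \<delta> E" if sep: "separated_set Y F T \<epsilon> E" for T E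
    unfolding delta_separated_set_def
  proof (intro conjI ballI impI)
    fix x y assume xy: "x \<in> E" "y \<in> E" "x \<noteq> y"
    then obtain t where t: "t \<in> {0..T}" "\<epsilon> \<le> dY (F t x) (F t y)"
      using sep unfolding separated_set_def by blast
    moreover have "x \<in> S" "y \<in> S" using sep xy unfolding separated_set_def by auto
    ultimately have "\<epsilon> / 2 \<le> delta_dist euclidean_metric F \<delta> (F t x) (F t y)"
      by (intro key impulsive_mem_S) auto
    then show "\<exists>t\<in>{0..T}. \<epsilon> / 2 \<le> delta_dist euclidean_metric F \<delta> (F t x) (F t y)" using t(1) by blast
  qed simp
  then show ?thesis using \<delta>(1) by blast
qed

lemma ex_fine_partition:
  assumes "0 < \<epsilon>" "0 < \<delta>" "0 < \<epsilon>'"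
    and small: "\<And>u v. u \<in> S \<Longrightarrow> v \<in> S \<Longrightarrow> dY u v < \<epsilon>' \<Longrightarrow> delta_dist euclidean_metric F \<delta> u v < \<epsilon>"
  obtains P where "finite P" "\<Union>P = UNIV"
    "\<And>A x y t. A \<in> P \<Longrightarrow> x \<in> A \<Longrightarrow> y \<in> A \<Longrightarrow> 0 \<le> t \<Longrightarrow> t \<le> \<xi> \<Longrightarrow>
      delta_dist euclidean_metric F \<delta> (F t x) (F t y) < \<epsilon>"
proof -
  obtain \<rho>1 where \<rho>1: "\<rho>1 > 0" "\<And>x y t. x \<in> S \<Longrightarrow> y \<in> S \<Longrightarrow> dist x y < \<rho>1 \<Longrightarrow> t \<in> {0..\<xi>} \<Longrightarrow> dY (F t x) (F t y) < \<epsilon>'"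
    using impulsive_equicontinuous_on_S[OF assms(3), of \<xi>] by metis
  obtain \<rho>2 where \<rho>2: "\<rho>2 > 0" "\<And>x y t. x \<in> -S \<Longrightarrow> y \<in> -S \<Longrightarrow> dist x y < \<rho>2 \<Longrightarrow> t \<in> {0..\<xi>} \<Longrightarrow> dist (F t x) (F t y) < \<epsilon>"
    using impulsive_equicontinuous_on_tube[OF assms(1)] by metis
  define \<rho> where "\<rho> = min \<rho>1 \<rho>2"
  have "\<rho> > 0" using \<rho>1(1) \<rho>2(1) by (simp add: \<rho>_def)
  then have "0 < \<rho> / 2" by simp
  with seq_compact_imp_totally_bounded[OF compact_imp_seq_compact[OF compact_UNIV]]
  obtain C where C: "finite C" "(UNIV :: 'a set) \<subseteq> (\<Union>c\<in>C. ball c (\<rho> / 2))" by blast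
  \<comment> \<open>Balls are cut along \<open>S\<close>: of two nearby points at D, one in
    \<open>S\<close> may jump soon while one in D does not, so their orbits need not stay close.
    Within \<open>S\<close> the glued metric is used, outside it d.\<close>
  define P where "P = (\<Union>c\<in>C. {ball c (\<rho> / 2) \<inter> S, ball c (\<rho> / 2) - S})"
  show thesis
  proof (rule that[of P])
    show "finite P" using C(1) by (simp add: P_def)
    show "\<Union>P = UNIV" using C(2) by (fastforce simp: P_def)
    fix A x y and t :: real assume A: "A \<in> P" "x \<in> A" "y \<in> A" and t: "0 \<le> t" "t \<le> \<xi>"
    obtain c where "x \<in> ball c (\<rho> / 2)" "y \<in> ball c (\<rho> / 2)" "x \<in> S \<longleftrightarrow> y \<in> S"
      using A by (auto simp: P_def)
    then have xy: "dist x y < \<rho>1" "dist x y < \<rho>2" "x \<in> S \<longleftrightarrow> y \<in> S"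
      using dist_triangle_half_r[of c x \<rho> y] by (auto simp: \<rho>_def)
    show "delta_dist euclidean_metric F \<delta> (F t x) (F t y) < \<epsilon>"
    proof (cases "x \<in> S")
      case True
      then show ?thesis using xy t \<rho>1(2)[of x y t] by (intro small impulsive_mem_S) auto
    next
      case False
      have "delta_dist euclidean_metric F \<delta> (F t x) (F t y) \<le> dist (F t x) (F t y)"
        using delta_dist_lower[of 0 \<delta> euclidean_metric F "F t x" "F t y"] assms(2) by simp
      also have "\<dots> < \<epsilon>" using False xy t by (intro \<rho>2(2)) auto
      finally show ?thesis .
    qed
  qed
qed

text \<open>Two points of a separated set in the same piece can be separated only after time \<xi>,
  when both orbits lie in \<open>S\<close>. Hence F \<xi> is injective on the piece and its image is
  separated in the glued metric; N is the number of pieces.\<close>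

lemma delta_sep_number_le:
  assumes "0 < \<epsilon>" "0 < \<delta>"
  shows "\<exists>\<epsilon>'>0. \<exists>N. \<forall>T\<ge>0. delta_sep_number euclidean_metric F \<delta> \<epsilon> T \<le> enat N * sep_number Y F \<epsilon>' T"
proof -
  obtain \<epsilon>' where \<epsilon>': "\<epsilon>' > 0"
    "\<And>u v. u \<in> S \<Longrightarrow> v \<in> S \<Longrightarrow> dY u v < \<epsilon>' \<Longrightarrow> delta_dist euclidean_metric F \<delta> u v < \<epsilon>"
    using delta_dist_small[OF assms] by metis
  obtain P where P: "finite P" "\<Union>P = UNIV"
    "\<And>A x y t. A \<in> P \<Longrightarrow> x \<in> A \<Longrightarrow> y \<in> A \<Longrightarrow> 0 \<le> t \<Longrightarrow> t \<le> \<xi> \<Longrightarrow>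
      delta_dist euclidean_metric F \<delta> (F t x) (F t y) < \<epsilon>"
    using ex_fine_partition[OF assms \<epsilon>'(1)] \<epsilon>'(2) by metis
  have "delta_sep_number euclidean_metric F \<delta> \<epsilon> T \<le> enat (card P) * sep_number Y F \<epsilon>' T" for T
  proof (intro delta_sep_number_least ecard_le_partition[OF P(1)])
    fix E A assume E: "delta_separated_set euclidean_metric F T \<epsilon> \<delta> E" and "A \<in> P"
    have sep: "\<exists>t\<in>{0..T}. \<epsilon>' \<le> dY (F t (F \<xi> x)) (F t (F \<xi> y))"
      if xy: "x \<in> E \<inter> A" "y \<in> E \<inter> A" "x \<noteq> y" for x y
    proof -
      obtain t where t: "t \<in> {0..T}" "\<epsilon> \<le> delta_dist euclidean_metric F \<delta> (F t x) (F t y)"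
        using E xy unfolding delta_separated_set_def by blast
      then have "\<xi> < t" using P(3)[OF \<open>A \<in> P\<close>, of x y t] xy by force
      then have split: "F t w = F (t - \<xi>) (F \<xi> w)" for w
        using impulsive_add[of \<xi> "t - \<xi>" w] \<xi>_pos by simp
      have "F t x \<in> S" "F t y \<in> S"
        using \<open>\<xi> < t\<close> unfolding split by (auto intro!: impulsive_mem_S impulsive_\<xi>_mem_S)
      then have "\<epsilon>' \<le> dY (F t x) (F t y)" using \<epsilon>'(2) t(2) by force
      moreover have "t - \<xi> \<in> {0..T}" using t(1) \<open>\<xi> < t\<close> \<xi>_pos by auto
      ultimately show ?thesis unfolding split by blast
    qed
    have "inj_on (F \<xi>) (E \<inter> A)"
    proof (rule inj_onI, rule ccontr)
      fix x y assume xy: "x \<in> E \<inter> A" "y \<in> E \<inter> A" "F \<xi> x = F \<xi> y" "x \<noteq> y"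
      then obtain t where "0 \<le> t" "\<epsilon>' \<le> dY (F t (F \<xi> x)) (F t (F \<xi> x))" using sep[of x y] by auto
      moreover have "F t (F \<xi> x) \<in> mspace Y" using impulsive_mem_S impulsive_\<xi>_mem_S \<open>0 \<le> t\<close> by simp
      then have "dY (F t (F \<xi> x)) (F t (F \<xi> x)) = 0" by (subst mdist_zero) auto
      ultimately show False using \<epsilon>'(1) by linarith
    qed
    then have "ecard (E \<inter> A) = ecard (F \<xi> ` (E \<inter> A))" by (simp add: ecard_image)
    also have "\<dots> \<le> sep_number Y F \<epsilon>' T"
    proof (rule sep_number_upper)
      show "separated_set Y F T \<epsilon>' (F \<xi> ` (E \<inter> A))"
        unfolding separated_set_def
      proof (intro conjI ballI impI)
        fix a b assume "a \<in> F \<xi> ` (E \<inter> A)" "b \<in> F \<xi> ` (E \<inter> A)" "a \<noteq> b"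
        then obtain x y where "x \<in> E \<inter> A" "y \<in> E \<inter> A" "x \<noteq> y" "a = F \<xi> x" "b = F \<xi> y" by blast
        then show "\<exists>t\<in>{0..T}. \<epsilon>' \<le> dY (F t a) (F t b)" using sep by blast
      qed (use impulsive_\<xi>_mem_S in auto)
    qed
    finally show "ecard (E \<inter> A) \<le> sep_number Y F \<epsilon>' T" .
  qed (use P(2) in simp)
  then show ?thesis using \<epsilon>'(1) by blast
qed

lemma entropy_eq: "top_entropy Y F = hat_entropy euclidean_metric F"
  unfolding top_entropy_eq hat_entropy_eq
proof (rule antisym)
  show "(SUP \<epsilon>\<in>{0<..}. growth_rate (sep_number Y F \<epsilon>)) \<le>
      (SUP \<delta>\<in>{0<..}. SUP \<epsilon>\<in>{0<..}. growth_rate (delta_sep_number euclidean_metric F \<delta> \<epsilon>))"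
  proof (rule SUP_least)
    fix \<epsilon> :: real assume "\<epsilon> \<in> {0<..}"
    then obtain \<delta> where \<delta>: "\<delta> > 0"
      "\<And>T E. separated_set Y F T \<epsilon> E \<Longrightarrow> delta_separated_set euclidean_metric F T (\<epsilon> / 2) \<delta> E"
      using separated_imp_delta_separated[of \<epsilon>] by auto
    have "growth_rate (sep_number Y F \<epsilon>) \<le> growth_rate (delta_sep_number euclidean_metric F \<delta> (\<epsilon> / 2))"
      by (intro growth_rate_mono sep_number_le_delta_sep_number \<delta>(2))
    then show "growth_rate (sep_number Y F \<epsilon>) \<le>
        (SUP \<delta>\<in>{0<..}. SUP \<epsilon>\<in>{0<..}. growth_rate (delta_sep_number euclidean_metric F \<delta> \<epsilon>))"
      using \<delta>(1) \<open>\<epsilon> \<in> {0<..}\<close> by (intro SUP_upper2[of \<delta>] SUP_upper2[of "\<epsilon> / 2"]) auto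
  qed
  show "(SUP \<delta>\<in>{0<..}. SUP \<epsilon>\<in>{0<..}. growth_rate (delta_sep_number euclidean_metric F \<delta> \<epsilon>)) \<le>
      (SUP \<epsilon>\<in>{0<..}. growth_rate (sep_number Y F \<epsilon>))"
  proof (intro SUP_least)
    fix \<delta> \<epsilon> :: real assume "\<delta> \<in> {0<..}" "\<epsilon> \<in> {0<..}"
    then obtain \<epsilon>' N where \<epsilon>': "\<epsilon>' > 0"
      "\<And>T. 0 \<le> T \<Longrightarrow> delta_sep_number euclidean_metric F \<delta> \<epsilon> T \<le> enat N * sep_number Y F \<epsilon>' T"
      using delta_sep_number_le[of \<epsilon> \<delta>] by auto
    \<comment> \<open>Any point of X serves here: its image at time \<xi> shows that the glued space
      is nonempty, so its separation numbers are at least 1.\<close>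
    have "F \<xi> undefined \<in> mspace Y" using impulsive_\<xi>_mem_S by simp
    then have "growth_rate (delta_sep_number euclidean_metric F \<delta> \<epsilon>) \<le> growth_rate (sep_number Y F \<epsilon>')"
      by (intro growth_rate_le_times[OF \<epsilon>'(2)] sep_number_ge_1)
    then show "growth_rate (delta_sep_number euclidean_metric F \<delta> \<epsilon>) \<le>
        (SUP \<epsilon>\<in>{0<..}. growth_rate (sep_number Y F \<epsilon>))"
      using \<epsilon>'(1) by (intro SUP_upper2[of \<epsilon>']) auto
  qed
qed

lemma compact_model:
  "\<exists>(Y :: 'a metric) \<psi> H.
     compact_space (mtopology_of Y) \<and>
     continuous_semiflow (mtopology_of Y) \<psi> \<and>
     uniformly_continuous_map (submetric euclidean_metric S) Y H \<and>
     bij_betw H S (mspace Y) \<and>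
     (\<forall>t\<ge>0. \<forall>x\<in>S. \<psi> t (H x) = H (F t x)) \<and>
     top_entropy Y \<psi> = hat_entropy euclidean_metric F"
proof (intro exI conjI)
  show "uniformly_continuous_map (submetric euclidean_metric S) Y id"
    unfolding uniformly_continuous_map_def
    by (auto intro: le_less_trans[OF glue.mdist_Y_le])
  show "bij_betw id S (mspace Y)" by simp
qed (auto simp: compact_space_Y continuous_semiflow_Y entropy_eq)

end

(* For the composition H o phi_t to be defined on X_xi, phi_t has to map X_xi to itself. This can
   fail for a regularity constant xi with I(D) meeting D_xi (circle rotation, D a single point,
   I moving it slightly forward), so xi is taken with I(D) disjoint from D_xi; the first conjunct
   says that every regular system has such a constant.
   A bijection transports the metric and the semiflow of Y along itself, so it is no loss of
   generality that the points of Y have the same type as those of X. *)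

theorem theorem3:
  fixes \<phi> :: "real \<Rightarrow> 'a::metric_space \<Rightarrow> 'a" and D :: "'a set" and I :: "'a \<Rightarrow> 'a"
  assumes "compact (UNIV :: 'a set)"
    and "regular_impulsive_system \<phi> D I"
  shows "(\<exists>\<eta> \<xi>. regularity_constants \<phi> D I \<eta> \<xi> \<and> I ` D \<inter> tube \<phi> D \<xi> = {}) \<and>
    (\<forall>\<eta> \<xi>. regularity_constants \<phi> D I \<eta> \<xi> \<and> I ` D \<inter> tube \<phi> D \<xi> = {} \<longrightarrow>
       (\<forall>t\<ge>0. impulsive_semiflow \<phi> D I t ` off_tube \<phi> D \<xi> \<subseteq> off_tube \<phi> D \<xi>) \<and>
       (\<exists>(Y :: 'a metric) \<psi> H.
          compact_space (mtopology_of Y) \<and>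
          continuous_semiflow (mtopology_of Y) \<psi> \<and>
          uniformly_continuous_map (submetric euclidean_metric (off_tube \<phi> D \<xi>)) Y H \<and>
          bij_betw H (off_tube \<phi> D \<xi>) (mspace Y) \<and>
          (\<forall>t\<ge>0. \<forall>x\<in>off_tube \<phi> D \<xi>. \<psi> t (H x) = H (impulsive_semiflow \<phi> D I t x)) \<and>
          top_entropy Y \<psi> = hat_entropy euclidean_metric (impulsive_semiflow \<phi> D I)))"
proof (intro conjI allI impI)
  have sys: "impulsive_system \<phi> D I" and disj: "I ` D \<inter> D = {}"
    using assms(2) by (auto simp: regular_impulsive_system_def)
  obtain L where L: "L-lipschitz_on D I" using assms(2) by (auto simp: regular_impulsive_system_def)
  have tube: "impulsive_tube \<phi> D I \<xi>" if "regularity_constants \<phi> D I \<eta> \<xi>" for \<eta> \<xi>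
    using that sys assms(1) by unfold_locales (auto simp: regularity_constants_def)
  show "\<exists>\<eta> \<xi>. regularity_constants \<phi> D I \<eta> \<xi> \<and> I ` D \<inter> tube \<phi> D \<xi> = {}"
  proof -
    obtain \<eta> \<xi> where reg: "regularity_constants \<phi> D I \<eta> \<xi>"
      using assms(2) by (auto simp: regular_impulsive_system_def)
    interpret impulsive_tube \<phi> D I \<xi> using tube[OF reg] .
    obtain \<zeta> where \<zeta>: "0 < \<zeta>" "\<zeta> \<le> \<xi> / 2" "I ` D \<inter> tube \<phi> D \<zeta> = {}"
      using tube_avoids_impulse_image[OF disj] by blast
    \<comment> \<open>The constant \<eta> is kept: \<zeta> < \<xi> preserves both the bound \<eta>/4
      and the condition on flowing from I(D), now demanded on a shorter time interval.\<close>
    then have "regularity_constants \<phi> D I \<eta> \<zeta>"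
      using reg shorter_tube[OF \<zeta>(1,2)] by (auto simp: regularity_constants_def)
    then show ?thesis using \<zeta>(3) by blast
  qed
  fix \<eta> \<xi> assume reg: "regularity_constants \<phi> D I \<eta> \<xi> \<and> I ` D \<inter> tube \<phi> D \<xi> = {}"
  interpret impulsive_regular \<phi> D I \<xi> L
  proof -
    interpret impulsive_tube \<phi> D I \<xi> using tube reg by blast
    show "impulsive_regular \<phi> D I \<xi> L" using reg disj L by unfold_locales auto
  qed
  show "F t ` S \<subseteq> S" if "0 \<le> t" for t using impulsive_mem_S that by blast
  show "\<exists>(Y :: 'a metric) \<psi> H.
     compact_space (mtopology_of Y) \<and>
     continuous_semiflow (mtopology_of Y) \<psi> \<and>
     uniformly_continuous_map (submetric euclidean_metric S) Y H \<and>
     bij_betw H S (mspace Y) \<and>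
     (\<forall>t\<ge>0. \<forall>x\<in>S. \<psi> t (H x) = H (F t x)) \<and>
     top_entropy Y \<psi> = hat_entropy euclidean_metric F"
    by (rule compact_model)
qed

end
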